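(* Let $s=s_n=n^{1-\alpha}$, fix $0<\alpha\le \frac12$ and set $C_{\mathrm{dense}}(\alpha)=\frac12-\alpha$. Then the following hold for the class $\mathcal{S}_k^{\nu}$ with any $\nu\ge 1$. (i) The Total Degree Test is asymptotically powerful against $\Xi(s_n,A_n)$ if $A=A_n\ge \frac{n^{-r}}{\sqrt a}$ with $r<C_{\mathrm{dense}}(\alpha)$. (ii) All tests are asymptotically powerless against $\Xi(s_n,A_n)$ if $A=A_n\le \frac{n^{-r}}{\sqrt a}$ with $r>C_{\mathrm{dense}}(\alpha)$.
   Context: **Model.** $k$ is a fixed number of communities. A community assignment is a partition $\mathcal{C}=\{\tilde S_1,\dots,\tilde S_k\}$ of $[n]=\{1,\dots,n\}$. For $\nu\ge1$, $\mathcal{S}_k^{\nu}$ is the set of all such partitions with $|\tilde S_l|\in[n/(k\nu),\,n\nu/k]$ for all $l$. For $\mathbf\Theta=(\theta_1,\dots,\theta_n)\in\mathbb{R}_+^n$ and sequences $a=a_n,b=b_n$, $\mathbb{P}^{(\mathcal C)}_{\mathbf\Theta,a,b}$ is the law of the simple random graph on $[n]$ with adjacency matrix $\mathbf Y=(Y_{ij})$ (symmetric, zero diagonal) whose edges are independent with $\mathbb{P}(Y_{ij}=1)=\min(\theta_i\theta_j\frac an,1)$ if $i,j$ lie in the same block of $\mathcal C$ and $\min(\theta_i\theta_j\frac bn,1)$ otherwise. **Standing assumptions.** $0<b<a\le n/2$; $0<\liminf \frac ba\le\limsup\frac ba<1$; $\liminf a>0$, $\liminf b>0$; the limits $\tau_a=\lim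 a/n$, $\tau_b=\lim b/n$ exist; $a,b$ are known (tests may depend on them). **Testing problem.** $\Xi(s,A)=\{\mathbf\Theta\in\mathbb{R}_+^n: |S(\mathbf\Theta)|=s,\ \theta_i\ge 1+A \text{ for } i\in S(\mathbf\Theta)\}$, where $A>0$ and $S(\mathbf\Theta)=\{i:\theta_i\ne1\}$. One tests $H_0:\mathbf\Theta=\mathbf 1$ against $H_1:\mathbf\Theta\in\Xi(s_n,A_n)$. A test $T_n$ is a measurable $\{0,1\}$-valued function of $\mathbf Y$ (value 1 means rejection), with worst-case risk $$\mathrm{Risk}_n(T_n,\Xi(s_n,A_n),\mathcal{S}_k^\nu)=\max_{\mathcal C\in\mathcal S_k^\nu}\mathbb{P}^{(\mathcal C)}_{\mathbf 1,a,b}(T_n=1)+\sup_{\mathbf\Theta\in\Xi(s_n,A_n)}\max_{\mathcal C\in\mathcal S_k^\nu}\mathbb{P}^{(\mathcal C)}_{\mathbf\Theta,a,b}(T_n=0).$$ A sequence of tests is asymptotically powerful if $\limsup_n\mathrm{Risk}_n=0$, and asymptotically powerless if $\liminf_n\mathrm{Risk}_n\ge1$. **Total Degree Test.** With $d_i=\sum_{j\neq i}Y_{ij}$, this is a test rejecting when $\sum_{i=1}^n d_i$ exceeds a suitably chosen cutoff (calibrated by its null behaviour); "the Total Degree Test is asymptotically powerful" means that it is so for a suitable choice of cutoff sequence.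
   Formalization: In (i) the cutoff is the null mean plus a multiple of the null standard deviation under the true assignment C, so for k≥2, ν>1 it depends on C (one cutoff for all C fails); s_n is n^(1-α) rounded, and limits run over n with a nonempty class. *)

theory Defs
  imports "HOL-Probability.Probability" "HOL-Library.Disjoint_Sets"
begin

text \<open>Vertices are \<open>{1..n}\<close>; a graph is given by its Boolean adjacency matrix \<open>Y\<close>, with
  \<open>Y i j\<close> standing for \<open>Y_ij = 1\<close>.\<close>

type_synonym adjacency = "nat \<Rightarrow> nat \<Rightarrow> bool"

definition community_class :: "nat \<Rightarrow> nat \<Rightarrow> real \<Rightarrow> nat set set set" where
  "community_class n k \<nu> = {C. partition_on {1..n} C \<and> card C = k \<and>
     (\<forall>B\<in>C. real (card B) \<in> {real n / (real k * \<nu>) .. real n * \<nu> / real k})}"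

text \<open>For \<open>\<nu> = 1\<close> the class is nonempty only when \<open>k\<close> divides \<open>n\<close>, and a maximum over the empty
  class has no meaning. Limits in \<open>n\<close> are therefore taken along the \<open>n\<close> with a nonempty class.
  If \<open>k > 0\<close> and \<open>\<nu> > 1\<close>, these are all sufficiently large \<open>n\<close>.\<close>

definition class_sequentially :: "nat \<Rightarrow> real \<Rightarrow> nat filter" where
  "class_sequentially k \<nu> = inf sequentially (principal {n. community_class n k \<nu> \<noteq> {}})"

definition same_block :: "nat set set \<Rightarrow> nat \<Rightarrow> nat \<Rightarrow> bool" where
  "same_block C i j \<longleftrightarrow> (\<exists>B\<in>C. i \<in> B \<and> j \<in> B)"

definition edge_prob ::
  "nat \<Rightarrow> real \<Rightarrow> real \<Rightarrow> nat set set \<Rightarrow> (nat \<Rightarrow> real) \<Rightarrow> nat \<Rightarrow> nat \<Rightarrow> real" where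
  "edge_prob n a b C \<Theta> i j =
     min (\<Theta> i * \<Theta> j * ((if same_block C i j then a else b) / real n)) 1"

definition graph_law ::
  "nat \<Rightarrow> real \<Rightarrow> real \<Rightarrow> nat set set \<Rightarrow> (nat \<Rightarrow> real) \<Rightarrow> adjacency pmf" where
  "graph_law n a b C \<Theta> =
     map_pmf (\<lambda>e i j. (i < j \<and> e (i, j)) \<or> (j < i \<and> e (j, i)))
       (Pi_pmf {(i, j). 1 \<le> i \<and> i < j \<and> j \<le> n} False
          (\<lambda>(i, j). bernoulli_pmf (edge_prob n a b C \<Theta> i j)))"

definition one_vec :: "nat \<Rightarrow> nat \<Rightarrow> real" where
  "one_vec n = (\<lambda>i\<in>{1..n}. 1)"

definition support :: "nat \<Rightarrow> (nat \<Rightarrow> real) \<Rightarrow> nat set" where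
  "support n \<Theta> = {i\<in>{1..n}. \<Theta> i \<noteq> 1}"

definition alternatives :: "nat \<Rightarrow> nat \<Rightarrow> real \<Rightarrow> (nat \<Rightarrow> real) set" where
  "alternatives n s A = {\<Theta> \<in> {1..n} \<rightarrow>\<^sub>E {0..}.
     card (support n \<Theta>) = s \<and> (\<forall>i\<in>support n \<Theta>. \<Theta> i \<ge> 1 + A)}"

text \<open>Worst-case risk of a family of rejection rules, one rule for each \<open>C\<close>. A test in the strict
  sense, a function of \<open>Y\<close> alone, is a constant family. The extra generality is used only for the
  Total Degree Test, whose calibration involves the null moments under \<open>C\<close>.\<close>

definition family_risk ::
  "nat \<Rightarrow> real \<Rightarrow> real \<Rightarrow> nat \<Rightarrow> real \<Rightarrow> nat \<Rightarrow> real \<Rightarrow>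
    (nat set set \<Rightarrow> adjacency \<Rightarrow> bool) \<Rightarrow> real" where
  "family_risk n a b k \<nu> s A T =
     (MAX C\<in>community_class n k \<nu>.
        measure_pmf.prob (graph_law n a b C (one_vec n)) {Y. T C Y})
   + (SUP \<Theta>\<in>alternatives n s A. MAX C\<in>community_class n k \<nu>.
        measure_pmf.prob (graph_law n a b C \<Theta>) {Y. \<not> T C Y})"

definition risk ::
  "nat \<Rightarrow> real \<Rightarrow> real \<Rightarrow> nat \<Rightarrow> real \<Rightarrow> nat \<Rightarrow> real \<Rightarrow> (adjacency \<Rightarrow> bool) \<Rightarrow> real" where
  "risk n a b k \<nu> s A T = family_risk n a b k \<nu> s A (\<lambda>_. T)"

definition asymptotically_powerful :: "nat filter \<Rightarrow> (nat \<Rightarrow> real) \<Rightarrow> bool" where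
  "asymptotically_powerful F R \<longleftrightarrow> Limsup F (\<lambda>n. ereal (R n)) = 0"

definition asymptotically_powerless :: "nat filter \<Rightarrow> (nat \<Rightarrow> real) \<Rightarrow> bool" where
  "asymptotically_powerless F R \<longleftrightarrow> Liminf F (\<lambda>n. ereal (R n)) \<ge> 1"

definition vertex_degree :: "nat \<Rightarrow> adjacency \<Rightarrow> nat \<Rightarrow> real" where
  "vertex_degree n Y i = (\<Sum>j\<in>{1..n} - {i}. of_bool (Y i j))"

definition total_degree :: "nat \<Rightarrow> adjacency \<Rightarrow> real" where
  "total_degree n Y = (\<Sum>i\<in>{1..n}. vertex_degree n Y i)"

text \<open>The cutoff is the null mean plus \<open>\<kappa>\<close> null standard deviations of the total degree. When
  \<open>k \<ge> 2\<close> and \<open>\<nu> > 1\<close>, the null mean varies over the community class by the order of \<open>n * a\<close>,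
  which can exceed the effect of the alternative, so a cutoff that ignores \<open>C\<close> cannot work in
  general. When \<open>\<nu> = 1\<close> or \<open>k = 1\<close>, the null moments, and hence the cutoff, do not depend on \<open>C\<close>,
  and this is a test in the strict sense.\<close>

definition total_degree_test ::
  "nat \<Rightarrow> real \<Rightarrow> real \<Rightarrow> real \<Rightarrow> nat set set \<Rightarrow> adjacency \<Rightarrow> bool" where
  "total_degree_test n a b \<kappa> C Y \<longleftrightarrow>
     total_degree n Y >
       measure_pmf.expectation (graph_law n a b C (one_vec n)) (total_degree n)
       + \<kappa> * sqrt (measure_pmf.variance (graph_law n a b C (one_vec n)) (total_degree n))"

definition C_dense :: "real \<Rightarrow> real" where
  "C_dense \<alpha> = 1 / 2 - \<alpha>"

end

theory Submission
  imports Defs "HOL-Real_Asymp.Real_Asymp"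
begin

text \<open>Under the null and under an alternative the edges are independent coins, and the total degree
  is twice their sum. Its standard deviation is of the order \<open>sqrt (n * a)\<close>, while the
  alternative, as long as no edge probability is truncated at 1, raises its mean by an amount of
  order \<open>s * n * (A * a / n) = s * A * a\<close>. With \<open>s\<close> of order \<open>n powr (1 - \<alpha>)\<close> the two balance at \<open>A * sqrt a\<close> of order \<open>n powr (\<alpha> - 1 / 2)\<close>, which is
  the threshold \<open>r = C_dense \<alpha>\<close>.

  Below the threshold exponent (\<open>r < C_dense \<alpha>\<close>) Chebyshev's inequality suffices. The variance
  of a sum of coins is at most its mean, so a large upward shift can inflate the variance under
  the alternative only by as much as it shifts the mean, and the error bound is uniform in \<open>\<Theta>\<close>
  (\<open>alternative_acceptance_prob\<close>). The shift itself is bounded below in \<open>mean_shift_ge\<close> by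
  counting only the pairs with exactly one end in the support.

  Above it (\<open>r > C_dense \<alpha>\<close>) the second moment method applies, for any single community
  structure \<open>C\<close>. The worst-case risk is at least the risk against a random alternative
  with \<open>\<theta> = 1 + A\<close> on a random set of \<open>s\<close> vertices, and that risk is at least
  \<open>1 - sqrt (K - 1)\<close>, where \<open>K\<close> is the null second moment of the mixture likelihood ratio
  (\<open>mixture_testing_lower_bound\<close>). Two planted sets \<open>S\<close> and \<open>S'\<close> contribute to \<open>K\<close> at most
  \<open>exp (8 * a * A\<^sup>2 * (card (S \<inter> S') + s\<^sup>2 / n))\<close> (\<open>planted_second_moment_le\<close>). The random set
  takes one vertex, independently and uniformly, from each of \<open>s\<close> disjoint blocks of
  \<open>n div s\<close> consecutive vertices. The overlap of two such sets is then exactly binomial with mean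
  of order \<open>s\<^sup>2 / n\<close>, its exponential moment factorises (\<open>sum_exp_overlap\<close>), and altogether
  \<open>K \<le> exp (40 * a * A\<^sup>2 * s\<^sup>2 / n)\<close>. The exponent is at most of order
  \<open>n powr (1 - 2 * \<alpha> - 2 * r)\<close>, which tends to 0.\<close>

section \<open>Graphs as independent coins\<close>

definition edge_set :: "nat \<Rightarrow> (nat \<times> nat) set" where
  "edge_set n = {(i, j). 1 \<le> i \<and> i < j \<and> j \<le> n}"

definition to_adjacency :: "(nat \<times> nat \<Rightarrow> bool) \<Rightarrow> adjacency" where
  "to_adjacency e = (\<lambda>i j. (i < j \<and> e (i, j)) \<or> (j < i \<and> e (j, i)))"

definition coin_law :: "'a set \<Rightarrow> ('a \<Rightarrow> real) \<Rightarrow> ('a \<Rightarrow> bool) pmf" where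
  "coin_law E q = Pi_pmf E False (\<lambda>x. bernoulli_pmf (q x))"

definition edge_coin ::
  "nat \<Rightarrow> real \<Rightarrow> real \<Rightarrow> nat set set \<Rightarrow> (nat \<Rightarrow> real) \<Rightarrow> nat \<times> nat \<Rightarrow> real" where
  "edge_coin n a b C \<Theta> = (\<lambda>(i, j). edge_prob n a b C \<Theta> i j)"

lemma finite_edge_set [simp]: "finite (edge_set n)"
  by (rule finite_subset[of _ "{1..n} \<times> {1..n}"]) (auto simp: edge_set_def)

lemma graph_law_eq_coin_law:
  "graph_law n a b C \<Theta> = map_pmf to_adjacency (coin_law (edge_set n) (edge_coin n a b C \<Theta>))"
  unfolding graph_law_def coin_law_def edge_set_def edge_coin_def to_adjacency_def
  by (simp add: case_prod_unfold)

text \<open>Each unordered pair of distinct vertices is counted once on the left and in both orders on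
  the right. The mean shift, the overlap bound and the number of pairs are all computed by
  passing to the right-hand side, where the two sums can be evaluated separately.\<close>

lemma sum_edge_set_sym:
  fixes u :: "nat \<Rightarrow> nat \<Rightarrow> real"
  shows "(\<Sum>(i, j)\<in>edge_set n. u i j + u j i) = (\<Sum>i\<in>{1..n}. \<Sum>j\<in>{1..n} - {i}. u i j)"
proof -
  have split: "Sigma {1..n} (\<lambda>i. {1..n} - {i}) = edge_set n \<union> prod.swap ` edge_set n"
    by (auto simp: edge_set_def image_iff)
  have disj: "edge_set n \<inter> prod.swap ` edge_set n = {}"
    by (auto simp: edge_set_def)
  have "(\<Sum>i\<in>{1..n}. \<Sum>j\<in>{1..n} - {i}. u i j) =
      (\<Sum>(i, j)\<in>Sigma {1..n} (\<lambda>i. {1..n} - {i}). u i j)"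
    by (subst sum.Sigma) auto
  also have "\<dots> = (\<Sum>(i, j)\<in>edge_set n. u i j) + (\<Sum>(i, j)\<in>prod.swap ` edge_set n. u i j)"
    unfolding split by (rule sum.union_disjoint) (use disj in auto)
  also have "(\<Sum>(i, j)\<in>prod.swap ` edge_set n. u i j) = (\<Sum>(i, j)\<in>edge_set n. u j i)"
    by (subst sum.reindex) (auto simp: case_prod_unfold)
  finally show ?thesis
    by (simp add: sum.distrib case_prod_unfold)
qed

lemma total_degree_to_adjacency:
  "total_degree n (to_adjacency e) = 2 * (\<Sum>x\<in>edge_set n. of_bool (e x))"
proof -
  have "total_degree n (to_adjacency e) =
      (\<Sum>(i, j)\<in>edge_set n. of_bool (to_adjacency e i j) + of_bool (to_adjacency e j i))"
    unfolding total_degree_def vertex_degree_def by (rule sum_edge_set_sym[symmetric])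
  also have "\<dots> = (\<Sum>x\<in>edge_set n. 2 * of_bool (e x))"
    by (rule sum.cong) (auto simp: edge_set_def to_adjacency_def)
  finally show ?thesis
    by (simp add: sum_distrib_left)
qed

lemma finite_set_coin_law [simp]: "finite E \<Longrightarrow> finite (set_pmf (coin_law E q))"
  unfolding coin_law_def
  by (rule finite_subset[OF set_Pi_pmf_subset']) auto

lemma integrable_coin_law [simp]:
  "finite E \<Longrightarrow> integrable (measure_pmf (coin_law E q)) (f :: _ \<Rightarrow> real)"
  by (rule integrable_measure_pmf_finite) simp

lemma expectation_coin_product:
  fixes h :: "'a \<Rightarrow> bool \<Rightarrow> real"
  assumes "finite E" "\<And>x. x \<in> E \<Longrightarrow> 0 \<le> q x \<and> q x \<le> 1" "\<And>x v. x \<in> E \<Longrightarrow> 0 \<le> h x v"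
  shows "measure_pmf.expectation (coin_law E q) (\<lambda>e. \<Prod>x\<in>E. h x (e x)) =
    (\<Prod>x\<in>E. h x True * q x + h x False * (1 - q x))"
  unfolding coin_law_def
  by (subst expectation_prod_Pi_pmf)
     (use assms in \<open>auto intro!: prod.cong integrable_measure_pmf_finite\<close>)

lemma expectation_coin_subset:
  assumes "finite E" "\<And>x. x \<in> E \<Longrightarrow> 0 \<le> q x \<and> q x \<le> 1" "F \<subseteq> E"
  shows "measure_pmf.expectation (coin_law E q) (\<lambda>e. \<Prod>x\<in>F. of_bool (e x)) = prod q F"
proof -
  have ext: "(\<Prod>x\<in>F. g x) = (\<Prod>x\<in>E. if x \<in> F then g x else 1)" for g :: "'a \<Rightarrow> real"
    using assms(1,3) by (simp add: prod.If_cases Int_absorb1)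
  have "measure_pmf.expectation (coin_law E q) (\<lambda>e. \<Prod>x\<in>F. of_bool (e x) :: real) =
      measure_pmf.expectation (coin_law E q)
        (\<lambda>e. \<Prod>x\<in>E. (if x \<in> F then of_bool (e x) else 1))"
    by (simp only: ext)
  also have "\<dots> = (\<Prod>x\<in>E. if x \<in> F then q x else 1)"
    by (subst expectation_coin_product[where h = "\<lambda>x v. if x \<in> F then of_bool v else 1"])
       (use assms in \<open>auto intro!: prod.cong\<close>)
  finally show ?thesis
    unfolding ext[of q] .
qed

lemma coin_sum_moments:
  fixes c :: real
  assumes E: "finite E" and q: "\<And>x. x \<in> E \<Longrightarrow> 0 \<le> q x \<and> q x \<le> 1"
  defines "X \<equiv> \<lambda>e. c * (\<Sum>x\<in>E. of_bool (e x) :: real)"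
  shows "measure_pmf.expectation (coin_law E q) X = c * (\<Sum>x\<in>E. q x)"
    and "measure_pmf.variance (coin_law E q) X = c\<^sup>2 * (\<Sum>x\<in>E. q x * (1 - q x))"
proof -
  let ?P = "coin_law E q" and ?Ex = "measure_pmf.expectation (coin_law E q)"
  have int: "integrable (measure_pmf ?P) f" for f :: "('a \<Rightarrow> bool) \<Rightarrow> real"
    using E by simp
  have one: "?Ex (\<lambda>e. of_bool (e x)) = q x" if "x \<in> E" for x
    using expectation_coin_subset[OF E q, where F = "{x}"] that by simp
  have two: "?Ex (\<lambda>e. of_bool (e x) * of_bool (e y)) = q x * q y + (if x = y then q x * (1 - q x) else 0)"
    if "x \<in> E" "y \<in> E" for x y
  proof (cases "x = y")
    case True
    have "(\<lambda>e. of_bool (e x) * of_bool (e x) :: real) = (\<lambda>e. of_bool (e x))"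
      by (auto simp: fun_eq_iff)
    with one[of x] True that show ?thesis
      by (simp add: algebra_simps)
  next
    case False
    with expectation_coin_subset[OF E q, where F = "{x, y}"] that show ?thesis by simp
  qed
  show mean: "?Ex X = c * (\<Sum>x\<in>E. q x)"
    unfolding X_def by (simp add: E one del: sum_of_bool_eq)
  have "?Ex (\<lambda>e. (X e)\<^sup>2) = ?Ex (\<lambda>e. c\<^sup>2 * (\<Sum>x\<in>E. \<Sum>y\<in>E. of_bool (e x) * of_bool (e y)))"
    unfolding X_def by (simp add: power2_eq_square sum_product mult_ac)
  also have "\<dots> = c\<^sup>2 * (\<Sum>x\<in>E. \<Sum>y\<in>E. ?Ex (\<lambda>e. of_bool (e x) * of_bool (e y)))"
    by (simp add: int del: of_bool_conj)
  also have "\<dots> = c\<^sup>2 * (\<Sum>x\<in>E. \<Sum>y\<in>E. q x * q y + (if x = y then q x * (1 - q x) else 0))"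
    by (intro arg_cong2[where f = "(*)"] refl sum.cong two)
  also have "\<dots> = (?Ex X)\<^sup>2 + c\<^sup>2 * (\<Sum>x\<in>E. q x * (1 - q x))"
    unfolding mean
    by (simp add: sum.distrib E power_mult_distrib distrib_left sum_product power2_eq_square)
  finally show "measure_pmf.variance ?P X = c\<^sup>2 * (\<Sum>x\<in>E. q x * (1 - q x))"
    by (subst measure_pmf.variance_eq) (simp_all add: int)
qed

section \<open>Error probabilities of the Total Degree Test\<close>

lemma total_degree_moments:
  fixes n a b C \<Theta>
  defines "q \<equiv> edge_coin n a b C \<Theta>"
  assumes q: "\<And>x. x \<in> edge_set n \<Longrightarrow> 0 \<le> q x \<and> q x \<le> 1"
  shows "measure_pmf.expectation (graph_law n a b C \<Theta>) (total_degree n) = 2 * sum q (edge_set n)"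
    and "measure_pmf.variance (graph_law n a b C \<Theta>) (total_degree n) =
      4 * (\<Sum>x\<in>edge_set n. q x * (1 - q x))"
    and "integrable (measure_pmf (graph_law n a b C \<Theta>)) (f :: _ \<Rightarrow> real)"
  using coin_sum_moments[OF finite_edge_set q, where c = 2]
  by (auto simp: graph_law_eq_coin_law total_degree_to_adjacency q_def)

lemma total_degree_test_iff:
  fixes n a b C
  defines "p \<equiv> edge_coin n a b C (one_vec n)"
  assumes p: "\<And>x. x \<in> edge_set n \<Longrightarrow> 0 \<le> p x \<and> p x \<le> 1"
  shows "total_degree_test n a b \<kappa> C Y \<longleftrightarrow>
    total_degree n Y > 2 * sum p (edge_set n) + \<kappa> * sqrt (4 * (\<Sum>x\<in>edge_set n. p x * (1 - p x)))"
proof -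
  have "measure_pmf.expectation (graph_law n a b C (one_vec n)) (total_degree n) = 2 * sum p (edge_set n)"
    unfolding p_def by (rule total_degree_moments) (use p in \<open>simp add: p_def\<close>)
  moreover have "measure_pmf.variance (graph_law n a b C (one_vec n)) (total_degree n) =
      4 * (\<Sum>x\<in>edge_set n. p x * (1 - p x))"
    unfolding p_def by (rule total_degree_moments) (use p in \<open>simp add: p_def\<close>)
  ultimately show ?thesis
    unfolding total_degree_test_def by simp
qed

lemma chebyshev_graph:
  fixes n a b C \<Theta>
  defines "q \<equiv> edge_coin n a b C \<Theta>"
  assumes q: "\<And>x. x \<in> edge_set n \<Longrightarrow> 0 \<le> q x \<and> q x \<le> 1" and "t > 0"
  shows "measure_pmf.prob (graph_law n a b C \<Theta>)
      {Y. t \<le> \<bar>total_degree n Y - 2 * sum q (edge_set n)\<bar>} \<le>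
      4 * (\<Sum>x\<in>edge_set n. q x * (1 - q x)) / t\<^sup>2"
  using measure_pmf.Chebyshev_inequality[of "total_degree n" "graph_law n a b C \<Theta>" t]
    total_degree_moments[of n a b C \<Theta>] q \<open>t > 0\<close>
  unfolding q_def by simp

lemma null_rejection_prob:
  fixes n a b C \<Theta>
  defines "p \<equiv> edge_coin n a b C (one_vec n)"
  assumes p: "\<And>x. x \<in> edge_set n \<Longrightarrow> 0 < p x \<and> p x < 1" and n: "n \<ge> 2" and \<kappa>: "\<kappa> > 0"
  shows "measure_pmf.prob (graph_law n a b C (one_vec n)) {Y. total_degree_test n a b \<kappa> C Y} \<le> 1 / \<kappa>\<^sup>2"
proof -
  have p': "x \<in> edge_set n \<Longrightarrow> 0 \<le> p x \<and> p x \<le> 1" for x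
    using p[of x] by auto
  define V where "V = 4 * (\<Sum>x\<in>edge_set n. p x * (1 - p x))"
  have "(1, 2) \<in> edge_set n"
    using n by (auto simp: edge_set_def)
  hence V: "V > 0"
    unfolding V_def using p by (intro mult_pos_pos sum_pos) auto
  note cutoff = total_degree_test_iff[of n a b C, folded p_def, OF p', folded V_def]
  have "measure_pmf.prob (graph_law n a b C (one_vec n)) {Y. total_degree_test n a b \<kappa> C Y} \<le>
     measure_pmf.prob (graph_law n a b C (one_vec n))
      {Y. \<kappa> * sqrt V \<le> \<bar>total_degree n Y - 2 * sum p (edge_set n)\<bar>}"
    by (rule measure_pmf.finite_measure_mono) (auto simp: cutoff)
  also have "\<dots> \<le> V / (\<kappa> * sqrt V)\<^sup>2"
    unfolding V_def p_def
    by (rule chebyshev_graph) (use p' \<kappa> V in \<open>auto simp: p_def V_def\<close>)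
  also have "\<dots> = 1 / \<kappa>\<^sup>2"
    using V \<kappa> by (simp add: power_mult_distrib)
  finally show ?thesis .
qed

text \<open>The variance under the alternative is at most \<open>4 * (M + \<Delta>)\<close>, and the total degree must fall
  short of its mean \<open>2 * (M + \<Delta>)\<close> by at least \<open>\<Delta>\<close> for the test to accept. The quotient
  \<open>4 * (M + \<Delta>) / \<Delta>\<^sup>2\<close> stays small however large the entries of \<open>\<Theta>\<close> are, since \<open>\<Delta>\<close> enters it
  linearly above and quadratically below.\<close>

lemma alternative_acceptance_prob:
  fixes n a b C \<Theta>
  defines "p \<equiv> edge_coin n a b C (one_vec n)" and "q \<equiv> edge_coin n a b C \<Theta>"
  defines "M \<equiv> sum p (edge_set n)" and "\<Delta> \<equiv> sum q (edge_set n) - sum p (edge_set n)"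
  assumes p: "\<And>x. x \<in> edge_set n \<Longrightarrow> 0 \<le> p x \<and> p x \<le> 1"
    and q: "\<And>x. x \<in> edge_set n \<Longrightarrow> 0 \<le> q x \<and> q x \<le> 1"
    and \<kappa>: "\<kappa> > 0" and M: "M \<ge> 1" and \<Delta>: "\<Delta> \<ge> 2 * \<kappa> * sqrt M"
  shows "measure_pmf.prob (graph_law n a b C \<Theta>) {Y. \<not> total_degree_test n a b \<kappa> C Y}
    \<le> 1 / \<kappa>\<^sup>2 + 2 / \<kappa>"
proof -
  define V where "V = 4 * (\<Sum>x\<in>edge_set n. p x * (1 - p x))"
  note cutoff = total_degree_test_iff[of n a b C, folded p_def, OF p, folded V_def]
  have "sqrt M \<ge> 1" using M by simp
  have "2 * \<kappa> * 1 \<le> 2 * \<kappa> * sqrt M"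
    using \<kappa> M by (intro mult_left_mono) auto
  hence \<Delta>1: "\<Delta> \<ge> 2 * \<kappa>" "\<Delta> > 0" using \<Delta> \<kappa> by linarith+
  have "(\<Sum>x\<in>edge_set n. p x * (1 - p x)) \<le> M"
    unfolding M_def using p by (intro sum_mono) (simp add: algebra_simps)
  hence "sqrt V \<le> sqrt (4 * M)" unfolding V_def by simp
  hence "\<kappa> * sqrt V \<le> \<kappa> * (2 * sqrt M)"
    using \<kappa> by (intro mult_left_mono) (auto simp: real_sqrt_mult)
  hence cut: "\<kappa> * sqrt V \<le> \<Delta>" using \<Delta> by simp
  have "measure_pmf.prob (graph_law n a b C \<Theta>) {Y. \<not> total_degree_test n a b \<kappa> C Y} \<le>
     measure_pmf.prob (graph_law n a b C \<Theta>)
      {Y. \<Delta> \<le> \<bar>total_degree n Y - 2 * sum q (edge_set n)\<bar>}"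
    using cut by (intro measure_pmf.finite_measure_mono)
      (auto simp: cutoff \<Delta>_def)
  also have "\<dots> \<le> 4 * (\<Sum>x\<in>edge_set n. q x * (1 - q x)) / \<Delta>\<^sup>2"
    unfolding q_def
    by (rule chebyshev_graph) (use q \<Delta>1 in \<open>auto simp: q_def\<close>)
  also have "\<dots> \<le> 4 * (M + \<Delta>) / \<Delta>\<^sup>2"
  proof -
    have "(\<Sum>x\<in>edge_set n. q x * (1 - q x)) \<le> sum q (edge_set n)"
      using q by (intro sum_mono) (simp add: algebra_simps)
    thus ?thesis by (intro divide_right_mono) (auto simp: M_def \<Delta>_def)
  qed
  also have "\<dots> = 4 * M / \<Delta>\<^sup>2 + 4 / \<Delta>"
    using \<Delta>1 by (simp add: field_simps power2_eq_square)
  also have "\<dots> \<le> 1 / \<kappa>\<^sup>2 + 2 / \<kappa>"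
  proof (rule add_mono)
    have "(2 * \<kappa> * sqrt M)\<^sup>2 \<le> \<Delta>\<^sup>2"
      using \<Delta> \<kappa> M by (intro power_mono) auto
    hence "4 * \<kappa>\<^sup>2 * M \<le> \<Delta>\<^sup>2" using M by (simp add: power_mult_distrib)
    thus "4 * M / \<Delta>\<^sup>2 \<le> 1 / \<kappa>\<^sup>2"
      using \<kappa> \<Delta>1 by (simp add: field_simps)
    show "4 / \<Delta> \<le> 2 / \<kappa>" using \<Delta>1 \<kappa> by (simp add: field_simps)
  qed
  finally show ?thesis .
qed

section \<open>The effect of an alternative on the mean\<close>

lemma edge_coin_null_bounds:
  assumes "0 < b" "b < a" "a \<le> real n / 2" "x \<in> edge_set n"
  shows "b / real n \<le> edge_coin n a b C (one_vec n) x"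
    and "edge_coin n a b C (one_vec n) x \<le> a / real n"
    and "0 < edge_coin n a b C (one_vec n) x"
    and "edge_coin n a b C (one_vec n) x \<le> 1 / 2"
proof -
  have n: "real n > 0" using assms by linarith
  have w: "b / real n < a / real n" "a / real n \<le> 1 / 2" "0 < b / real n"
    using assms n by (auto simp: field_simps)
  hence "min (a / real n) 1 = a / real n" "min (b / real n) 1 = b / real n"
    by linarith+
  hence "edge_coin n a b C (one_vec n) x \<in> {a / real n, b / real n}"
    using assms(4) by (auto simp: edge_coin_def edge_prob_def one_vec_def edge_set_def)
  thus "b / real n \<le> edge_coin n a b C (one_vec n) x"
    and "edge_coin n a b C (one_vec n) x \<le> a / real n"
    and "0 < edge_coin n a b C (one_vec n) x"
    and "edge_coin n a b C (one_vec n) x \<le> 1 / 2"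
    using w by (elim insertE emptyE; linarith)+
qed

text \<open>Null edge probabilities are at most \<open>1 / 2\<close>, hence not truncated, so an alternative acts on them
  by multiplication and a single truncation.\<close>

lemma edge_coin_scale:
  assumes "0 < b" "b < a" "a \<le> real n / 2" "(i, j) \<in> edge_set n"
  shows "edge_coin n a b C \<Theta> (i, j) = min (\<Theta> i * \<Theta> j * edge_coin n a b C (one_vec n) (i, j)) 1"
proof -
  have n: "real n > 0" using assms by linarith
  hence "b / real n < a / real n" "a / real n \<le> 1 / 2"
    using assms by (auto simp: field_simps)
  hence "min (a / real n) 1 = a / real n" "min (b / real n) 1 = b / real n"
    by linarith+
  thus ?thesis
    using assms(4) by (auto simp: edge_coin_def edge_prob_def one_vec_def edge_set_def)
qed

lemma alternatives_ge_1:
  assumes "\<Theta> \<in> alternatives n s A" "A > 0" "i \<in> {1..n}"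
  shows "\<Theta> i \<ge> 1"
  using assms by (cases "\<Theta> i = 1") (auto simp: alternatives_def support_def dest!: bspec)

lemma edge_coin_alternative_bounds:
  assumes ab: "0 < b" "b < a" "a \<le> real n / 2" and x: "x \<in> edge_set n"
    and \<Theta>: "\<Theta> \<in> alternatives n s A" "A > 0"
  shows "edge_coin n a b C (one_vec n) x \<le> edge_coin n a b C \<Theta> x"
    and "edge_coin n a b C \<Theta> x \<le> 1"
proof -
  obtain i j where ij: "x = (i, j)" by force
  let ?p = "edge_coin n a b C (one_vec n) (i, j)"
  have ijn: "i \<in> {1..n}" "j \<in> {1..n}"
    using x by (auto simp: ij edge_set_def)
  have "1 * 1 \<le> \<Theta> i * \<Theta> j"
    using alternatives_ge_1[OF \<Theta>] ijn by (intro mult_mono) fastforce+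
  hence "1 * ?p \<le> \<Theta> i * \<Theta> j * ?p"
    using edge_coin_null_bounds(3)[OF ab x, of C] by (intro mult_right_mono) (auto simp: ij)
  thus "edge_coin n a b C (one_vec n) x \<le> edge_coin n a b C \<Theta> x"
    using edge_coin_null_bounds(4)[OF ab x, of C] x
    by (simp add: ij edge_coin_scale[OF ab, of _ _ C \<Theta>])
  show "edge_coin n a b C \<Theta> x \<le> 1"
    using x by (simp add: ij edge_coin_scale[OF ab, of _ _ C \<Theta>])
qed

text \<open>A pair with exactly one end in the support has its probability \<open>p\<close> raised to at least
  \<open>min ((1 + A) * p) 1\<close>, a gain of at least \<open>min (A * b / n) (1 / 2)\<close> because
  \<open>b / n \<le> p \<le> 1 / 2\<close>. There are \<open>s * (n - s)\<close> such pairs, and no other pair loses.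
  The value \<open>1 / 2\<close> accounts for edge probabilities that the alternative pushes up to 1.\<close>

lemma mean_shift_ge:
  assumes ab: "0 < b" "b < a" "a \<le> real n / 2"
    and \<Theta>: "\<Theta> \<in> alternatives n s A" and A: "A > 0"
  shows "real s * (real n - real s) * min (A * b / real n) (1 / 2) \<le>
    sum (edge_coin n a b C \<Theta>) (edge_set n) - sum (edge_coin n a b C (one_vec n)) (edge_set n)"
proof -
  define S where "S = support n \<Theta>"
  define \<mu> where "\<mu> = min (A * b / real n) (1 / 2)"
  let ?p = "edge_coin n a b C (one_vec n)" and ?q = "edge_coin n a b C \<Theta>"
  \<comment> \<open>\<open>u i j + u j i\<close> indicates that exactly one of \<open>i\<close>, \<open>j\<close> lies in \<open>S\<close>.\<close>
  define u :: "nat \<Rightarrow> nat \<Rightarrow> real" where "u i j = of_bool (i \<in> S \<and> j \<notin> S)" for i j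
  have S: "S \<subseteq> {1..n}" "card S = s" "\<And>i. i \<in> S \<Longrightarrow> 1 + A \<le> \<Theta> i"
    "\<And>i. i \<in> {1..n} \<Longrightarrow> i \<notin> S \<Longrightarrow> \<Theta> i = 1"
    using \<Theta> by (auto simp: S_def alternatives_def support_def)
  have fS: "finite S" using S(1) finite_subset by blast
  have sn: "s \<le> n" using card_mono[OF _ S(1)] S(2) by simp
  have edge: "\<mu> * (u i j + u j i) \<le> ?q (i, j) - ?p (i, j)" if ij: "(i, j) \<in> edge_set n" for i j
  proof (cases "(i \<in> S) = (j \<in> S)")
    case True
    thus ?thesis
      using edge_coin_alternative_bounds(1)[OF ab ij \<Theta> A, of C] by (auto simp: u_def)
  next
    case False
    have ijn: "i \<in> {1..n}" "j \<in> {1..n}"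
      using ij by (auto simp: edge_set_def)
    have "1 + A \<le> \<Theta> i * \<Theta> j"
      using False S(3,4) ijn by (cases "i \<in> S") auto
    hence "(1 + A) * ?p (i, j) \<le> \<Theta> i * \<Theta> j * ?p (i, j)"
      using edge_coin_null_bounds(3)[OF ab ij, of C] by (intro mult_right_mono) auto
    moreover have "A * (b / real n) \<le> A * ?p (i, j)"
      using edge_coin_null_bounds(1)[OF ab ij, of C] A by (intro mult_left_mono) auto
    ultimately have "min (A * b / real n) (1 / 2) \<le> ?q (i, j) - ?p (i, j)"
      using edge_coin_null_bounds(4)[OF ab ij, of C]
      unfolding edge_coin_scale[OF ab ij, of C \<Theta>] distrib_right mult_1 times_divide_eq_right
      by linarith
    moreover have "u i j + u j i = 1" using False by (auto simp: u_def)
    ultimately show ?thesis by (simp add: \<mu>_def)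
  qed
  have inner: "(\<Sum>j\<in>{1..n} - {i}. u i j) = (if i \<in> S then real n - real s else 0)"
    if "i \<in> {1..n}" for i
  proof (cases "i \<in> S")
    case True
    have "(\<Sum>j\<in>{1..n} - {i}. u i j) = (\<Sum>j\<in>{1..n} - S. 1)"
      using True by (intro sum.mono_neutral_cong_right) (auto simp: u_def)
    also have "\<dots> = real (card ({1..n} - S))" by simp
    also have "\<dots> = real n - real s"
      using S(1,2) fS sn by (simp add: card_Diff_subset of_nat_diff)
    finally show ?thesis using True by simp
  qed (simp add: u_def)
  have "(\<Sum>(i, j)\<in>edge_set n. u i j + u j i) = (\<Sum>i\<in>{1..n}. if i \<in> S then real n - real s else 0)"
    unfolding sum_edge_set_sym by (rule sum.cong) (use inner in auto)
  also have "\<dots> = (\<Sum>i\<in>S. real n - real s)"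
    by (subst sum.inter_restrict[symmetric]) (use S(1) in \<open>simp_all add: Int_absorb1\<close>)
  also have "\<dots> = real s * (real n - real s)"
    using S(2) by simp
  finally have "real s * (real n - real s) * \<mu> = (\<Sum>(i, j)\<in>edge_set n. \<mu> * (u i j + u j i))"
    by (simp add: sum_distrib_left[symmetric] case_prod_unfold mult.commute[of _ \<mu>])
  also have "\<dots> \<le> (\<Sum>x\<in>edge_set n. ?q x - ?p x)"
    by (intro sum_mono) (use edge in auto)
  finally show ?thesis
    by (simp add: sum_subtractf \<mu>_def)
qed

lemma card_edge_set: "2 * real (card (edge_set n)) = real n * (real n - 1)"
proof -
  have "2 * real (card (edge_set n)) = (\<Sum>(i, j)\<in>edge_set n. 1 + 1)"
    by simp
  also have "\<dots> = (\<Sum>i\<in>{1..n}. \<Sum>j\<in>{1..n} - {i}. 1)"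
    by (rule sum_edge_set_sym)
  also have "\<dots> = (\<Sum>i\<in>{1..n}. real n - 1)"
    by (rule sum.cong) (auto simp: of_nat_diff)
  finally show ?thesis by simp
qed

section \<open>Worst-case risk of the Total Degree Test\<close>

lemma finite_community_class [simp]: "finite (community_class n k \<nu>)"
proof (rule finite_subset)
  show "community_class n k \<nu> \<subseteq> Pow (Pow {1..n})"
    by (auto simp: community_class_def partition_on_def)
qed simp

definition planted :: "nat \<Rightarrow> real \<Rightarrow> nat set \<Rightarrow> nat \<Rightarrow> real" where
  "planted n A S = (\<lambda>i\<in>{1..n}. if i \<in> S then 1 + A else 1)"

lemma planted_in_alternatives:
  assumes "S \<subseteq> {1..n}" "card S = s" "A > 0"
  shows "planted n A S \<in> alternatives n s A"
proof -
  have "support n (planted n A S) = S"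
    using assms by (auto simp: support_def planted_def)
  thus ?thesis using assms by (auto simp: alternatives_def planted_def)
qed

text \<open>A supremum of reals over the empty set has no definite value, so the sign of the risk rests on
  the existence of an alternative, which \<open>s \<le> n\<close> provides.\<close>

lemma family_risk_nonneg:
  assumes "community_class n k \<nu> \<noteq> {}" "s \<le> n" "A > 0"
  shows "0 \<le> family_risk n a b k \<nu> s A T"
proof -
  let ?CC = "community_class n k \<nu>"
  obtain C where C: "C \<in> ?CC" using assms by blast
  have max: "0 \<le> (MAX C\<in>?CC. measure_pmf.prob (G C) (R C))"
    "(MAX C\<in>?CC. measure_pmf.prob (G C) (R C)) \<le> 1"
    for G :: "nat set set \<Rightarrow> adjacency pmf" and R
    using C assms(1) by (auto simp: Max_ge_iff)
  have "{1..s} \<subseteq> {1..n}" using assms(2) by auto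
  from planted_in_alternatives[OF this _ assms(3)] obtain \<Theta> where \<Theta>: "\<Theta> \<in> alternatives n s A"
    by force
  have "0 \<le> (SUP \<Theta>\<in>alternatives n s A. MAX C\<in>?CC.
      measure_pmf.prob (graph_law n a b C \<Theta>) {Y. \<not> T C Y})"
    by (rule cSUP_upper2[OF _ \<Theta>]) (use max in \<open>auto intro!: bdd_aboveI[of _ 1]\<close>)
  thus ?thesis
    unfolding family_risk_def by (intro add_nonneg_nonneg max)
qed

lemma total_degree_test_family_risk:
  assumes ab: "0 < b" "b < a" "a \<le> real n / 2" and n: "n \<ge> 2"
    and CC: "community_class n k \<nu> \<noteq> {}" and s: "s \<le> n" and A: "A > 0" and \<kappa>: "\<kappa> > 0"
    and M: "(real n - 1) * b \<ge> 2"
    and signal: "2 * \<kappa> * sqrt (real n * a) \<le> real s * (real n - real s) * min (A * b / real n) (1 / 2)"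
  shows "family_risk n a b k \<nu> s A (total_degree_test n a b \<kappa>) \<le> 2 / \<kappa>\<^sup>2 + 2 / \<kappa>"
proof -
  let ?p = "\<lambda>C. edge_coin n a b C (one_vec n)" and ?q = "edge_coin n a b"
  have null: "measure_pmf.prob (graph_law n a b C (one_vec n)) {Y. total_degree_test n a b \<kappa> C Y}
      \<le> 1 / \<kappa>\<^sup>2" for C
    using edge_coin_null_bounds(3,4)[OF ab, of _ C] n \<kappa>
    by (intro null_rejection_prob) force+
  have alt: "measure_pmf.prob (graph_law n a b C \<Theta>) {Y. \<not> total_degree_test n a b \<kappa> C Y}
      \<le> 1 / \<kappa>\<^sup>2 + 2 / \<kappa>" if \<Theta>: "\<Theta> \<in> alternatives n s A" for C \<Theta>
  proof (rule alternative_acceptance_prob)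
    show p: "0 \<le> ?p C x \<and> ?p C x \<le> 1" if "x \<in> edge_set n" for x
      using edge_coin_null_bounds(3,4)[OF ab that, of C] by linarith
    show "0 \<le> ?q C \<Theta> x \<and> ?q C \<Theta> x \<le> 1" if "x \<in> edge_set n" for x
      using edge_coin_alternative_bounds[OF ab that \<Theta> A, of C] p[OF that] by linarith
    have "2 * 1 \<le> (real n - 1) * b" using M by simp
    also have "\<dots> = 2 * real (card (edge_set n)) * (b / real n)"
      unfolding card_edge_set using n by simp
    also have "\<dots> \<le> 2 * sum (?p C) (edge_set n)"
      using sum_bounded_below[of "edge_set n" "b / real n" "?p C"] edge_coin_null_bounds(1)[OF ab]
      by simp
    finally show "1 \<le> sum (?p C) (edge_set n)" by simp
    have "2 * sum (?p C) (edge_set n) \<le> 2 * real (card (edge_set n)) * (a / real n)"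
      using sum_bounded_above[of "edge_set n" "?p C" "a / real n"] edge_coin_null_bounds(2)[OF ab]
      by simp
    also have "\<dots> = (real n - 1) * a"
      unfolding card_edge_set using n by simp
    also have "\<dots> \<le> 2 * (real n * a)"
      using ab n by (simp add: algebra_simps)
    finally have "sqrt (sum (?p C) (edge_set n)) \<le> sqrt (real n * a)" by simp
    hence "2 * \<kappa> * sqrt (sum (?p C) (edge_set n)) \<le> 2 * \<kappa> * sqrt (real n * a)"
      using \<kappa> by (intro mult_left_mono) auto
    with signal mean_shift_ge[OF ab \<Theta> A, of C]
    show "2 * \<kappa> * sqrt (sum (?p C) (edge_set n)) \<le>
        sum (?q C \<Theta>) (edge_set n) - sum (?p C) (edge_set n)"
      by linarith
  qed (fact \<kappa>)
  have "{1..s} \<subseteq> {1..n}" using s by auto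
  from planted_in_alternatives[OF this _ A] have ne: "alternatives n s A \<noteq> {}" by force
  have "family_risk n a b k \<nu> s A (total_degree_test n a b \<kappa>) \<le> 1 / \<kappa>\<^sup>2 + (1 / \<kappa>\<^sup>2 + 2 / \<kappa>)"
    unfolding family_risk_def
    using CC null alt ne by (intro add_mono cSUP_least) auto
  thus ?thesis by simp
qed

section \<open>The second moment method\<close>

definition coin_ratio :: "real \<Rightarrow> real \<Rightarrow> bool \<Rightarrow> real" where
  "coin_ratio p q v = (if v then q / p else (1 - q) / (1 - p))"

definition likelihood_ratio :: "'a set \<Rightarrow> ('a \<Rightarrow> real) \<Rightarrow> ('a \<Rightarrow> real) \<Rightarrow> ('a \<Rightarrow> bool) \<Rightarrow> real" where
  "likelihood_ratio E p q e = (\<Prod>x\<in>E. coin_ratio (p x) (q x) (e x))"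

lemma pmf_coin_law_likelihood_ratio:
  assumes "finite E" "\<And>x. x \<in> E \<Longrightarrow> 0 < p x \<and> p x < 1" "\<And>x. x \<in> E \<Longrightarrow> 0 \<le> q x \<and> q x \<le> 1"
  shows "pmf (coin_law E q) e = pmf (coin_law E p) e * likelihood_ratio E p q e"
proof -
  have "pmf (bernoulli_pmf (q x)) v = pmf (bernoulli_pmf (p x)) v * coin_ratio (p x) (q x) v"
    if "x \<in> E" for x v
    using assms(2,3)[OF that] by (cases v) (auto simp: coin_ratio_def)
  hence "(\<Prod>x\<in>E. pmf (bernoulli_pmf (q x)) (e x)) =
      (\<Prod>x\<in>E. pmf (bernoulli_pmf (p x)) (e x)) * likelihood_ratio E p q e"
    unfolding likelihood_ratio_def prod.distrib[symmetric] by (rule prod.cong[OF refl])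
  thus ?thesis
    unfolding coin_law_def pmf_Pi[OF assms(1)] by auto
qed

text \<open>The coins are independent, so the second moment factorises; each factor is
  \<open>q * q' / p + (1 - q) * (1 - q') / (1 - p)\<close> rewritten around its value 1 at \<open>q = p\<close>.\<close>

lemma expectation_likelihood_ratio_product:
  assumes "finite E" "\<And>x. x \<in> E \<Longrightarrow> 0 < p x \<and> p x < 1"
    "\<And>x. x \<in> E \<Longrightarrow> 0 \<le> q x \<and> q x \<le> 1" "\<And>x. x \<in> E \<Longrightarrow> 0 \<le> q' x \<and> q' x \<le> 1"
  shows "measure_pmf.expectation (coin_law E p)
      (\<lambda>e. likelihood_ratio E p q e * likelihood_ratio E p q' e) =
    (\<Prod>x\<in>E. 1 + (q x - p x) * (q' x - p x) / (p x * (1 - p x)))"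
proof -
  define h where "h = (\<lambda>x v. coin_ratio (p x) (q x) v * coin_ratio (p x) (q' x) v)"
  have "(\<lambda>e. likelihood_ratio E p q e * likelihood_ratio E p q' e) = (\<lambda>e. \<Prod>x\<in>E. h x (e x))"
    by (simp add: likelihood_ratio_def prod.distrib h_def)
  moreover have "measure_pmf.expectation (coin_law E p) (\<lambda>e. \<Prod>x\<in>E. h x (e x)) =
      (\<Prod>x\<in>E. h x True * p x + h x False * (1 - p x))"
  proof (rule expectation_coin_product)
    show "0 \<le> p x \<and> p x \<le> 1" if "x \<in> E" for x
      using assms(2)[OF that] by simp
    show "0 \<le> h x v" if "x \<in> E" for x v
      using assms(2-4)[OF that] by (auto simp: h_def coin_ratio_def)
  qed (fact assms(1))
  moreover have "h x True * p x + h x False * (1 - p x) =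
      1 + (q x - p x) * (q' x - p x) / (p x * (1 - p x))" if "x \<in> E" for x
  proof -
    have "p x \<noteq> 0" "1 - p x \<noteq> 0" using assms(2)[OF that] by auto
    thus ?thesis
      unfolding h_def coin_ratio_def by (simp add: divide_simps) (simp add: algebra_simps)
  qed
  ultimately show ?thesis by (simp cong: prod.cong)
qed

text \<open>The average of the laws \<open>Q f\<close> has density \<open>Lbar\<close>, the average of the \<open>L f\<close>, with respect to
  \<open>P\<close>. The sum of the two errors is \<open>1 - E\<^sub>P (indicator T * (Lbar - 1))\<close>, and by
  Cauchy-Schwarz the subtracted term is at most the \<open>L\<^sup>2\<close> norm of \<open>Lbar - 1\<close>, whose square is
  the second moment of \<open>Lbar\<close> minus 1.\<close>

lemma mixture_testing_lower_bound:
  fixes P :: "'b pmf" and Q :: "'i \<Rightarrow> 'b pmf" and L :: "'i \<Rightarrow> 'b \<Rightarrow> real"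
  assumes P: "finite (set_pmf P)" and I: "finite I" "I \<noteq> {}"
    and L: "\<And>f e. f \<in> I \<Longrightarrow> pmf (Q f) e = pmf P e * L f e"
    and K: "(\<Sum>f\<in>I. \<Sum>g\<in>I. measure_pmf.expectation P (\<lambda>e. L f e * L g e)) \<le> K * (real (card I))\<^sup>2"
  shows "1 - sqrt (K - 1) \<le>
    measure_pmf.prob P T + (\<Sum>f\<in>I. measure_pmf.prob (Q f) (- T)) / real (card I)"
proof -
  let ?E = "measure_pmf.expectation P" and ?N = "real (card I)"
  have N: "?N > 0" using I by (simp add: card_gt_0_iff)
  have int [simp]: "integrable (measure_pmf P) h" for h :: "'b \<Rightarrow> real"
    using P by (rule integrable_measure_pmf_finite)
  have Q: "measure_pmf.prob (Q f) U = ?E (\<lambda>e. indicator U e * L f e)" if f: "f \<in> I" for f U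
  proof -
    have sub: "set_pmf (Q f) \<subseteq> set_pmf P"
      using L[OF f] by (auto simp: set_pmf_iff)
    have "measure_pmf.prob (Q f) U = measure_pmf.expectation (Q f) (indicator U)"
      by simp
    also have "\<dots> = (\<Sum>e\<in>set_pmf P. indicator U e * pmf (Q f) e)"
      by (rule integral_measure_pmf_real) (use P sub in auto)
    also have "\<dots> = (\<Sum>e\<in>set_pmf P. (indicator U e * L f e) * pmf P e)"
      by (simp add: L[OF f] mult_ac)
    also have "\<dots> = ?E (\<lambda>e. indicator U e * L f e)"
      by (rule integral_measure_pmf_real[symmetric]) (use P in auto)
    finally show ?thesis .
  qed
  define Lbar where "Lbar e = (\<Sum>f\<in>I. L f e) / ?N" for e
  define Z where "Z e = indicator T e * (Lbar e - 1)" for e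
  have EL: "?E (L f) = 1" if "f \<in> I" for f
    using Q[OF that, of UNIV] by simp
  have ELbar: "?E Lbar = 1"
    unfolding Lbar_def using N by (simp add: EL)
  have "?E (\<lambda>e. (Lbar e)\<^sup>2) = ?E (\<lambda>e. (\<Sum>f\<in>I. \<Sum>g\<in>I. L f e * L g e) / ?N\<^sup>2)"
    by (simp add: Lbar_def power_divide power2_eq_square sum_product)
  also have "\<dots> = (\<Sum>f\<in>I. \<Sum>g\<in>I. ?E (\<lambda>e. L f e * L g e)) / ?N\<^sup>2"
    by simp
  also have "\<dots> \<le> K"
    using K N by (simp add: field_simps)
  finally have second: "?E (\<lambda>e. (Lbar e)\<^sup>2) \<le> K" .
  \<comment> \<open>Cauchy-Schwarz, in the form that the variance of \<open>Z\<close> is nonnegative.\<close>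
  have "(?E Z)\<^sup>2 \<le> ?E (\<lambda>e. (Z e)\<^sup>2)"
    using measure_pmf.variance_positive[of P Z] by (simp add: measure_pmf.variance_eq)
  also have "\<dots> \<le> ?E (\<lambda>e. (Lbar e - 1)\<^sup>2)"
    by (rule integral_mono) (auto simp: Z_def indicator_def)
  also have "\<dots> = ?E (\<lambda>e. (Lbar e)\<^sup>2) - 1"
    using measure_pmf.variance_eq[of P Lbar] by (simp add: ELbar)
  also have "\<dots> \<le> K - 1" using second by simp
  finally have EZ: "?E Z \<le> sqrt (K - 1)"
    by (rule real_le_rsqrt)
  have "?E Z = (\<Sum>f\<in>I. ?E (\<lambda>e. indicator T e * L f e)) / ?N - measure_pmf.prob P T"
  proof -
    have "Z = (\<lambda>e. (\<Sum>f\<in>I. indicator T e * L f e) / ?N - indicator T e)"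
      by (auto simp: Z_def Lbar_def fun_eq_iff sum_distrib_left algebra_simps)
    thus ?thesis by simp
  qed
  also have "\<dots> = (\<Sum>f\<in>I. measure_pmf.prob (Q f) T) / ?N - measure_pmf.prob P T"
    by (simp add: Q)
  also have "(\<Sum>f\<in>I. measure_pmf.prob (Q f) T) / ?N = 1 - (\<Sum>f\<in>I. measure_pmf.prob (Q f) (- T)) / ?N"
  proof -
    have "(\<Sum>f\<in>I. measure_pmf.prob (Q f) T) = (\<Sum>f\<in>I. 1 - measure_pmf.prob (Q f) (- T))"
      by (rule sum.cong) (auto simp: measure_pmf.prob_compl[symmetric] Compl_eq_Diff_UNIV double_diff)
    thus ?thesis using N by (simp add: sum_subtractf diff_divide_distrib)
  qed
  finally show ?thesis using EZ by simp
qed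

section \<open>The random planted set\<close>

text \<open>Block \<open>t < s\<close> consists of the \<open>m\<close> vertices after \<open>t * m\<close>; the summand 1 is there because
  vertices are numbered from 1.\<close>

definition block_choice :: "nat \<Rightarrow> nat \<Rightarrow> (nat \<Rightarrow> nat) \<Rightarrow> nat set" where
  "block_choice s m f = (\<lambda>t. t * m + f t + 1) ` {..<s}"

abbreviation block_choices :: "nat \<Rightarrow> nat \<Rightarrow> (nat \<Rightarrow> nat) set" where
  "block_choices s m \<equiv> PiE {..<s} (\<lambda>_. {..<m})"

lemma block_position_inj:
  fixes m :: nat
  assumes "t * m + v = t' * m + v'" "v < m" "v' < m"
  shows "t = t' \<and> v = v'"
proof -
  have "(t * m + v) div m = t" "(t' * m + v') div m = t'"
    using assms(2,3) by auto
  with assms(1) show ?thesis by auto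
qed

lemma block_choice_props:
  assumes f: "f \<in> block_choices s m"
  shows "block_choice s m f \<subseteq> {1..s * m}" and "card (block_choice s m f) = s"
proof -
  have lt: "f t < m" if "t < s" for t using f that by auto
  have "t * m + f t + 1 \<le> s * m" if t: "t < s" for t
  proof -
    have "t * m + m \<le> s * m"
      using t mult_le_mono1[of "Suc t" s m] by simp
    thus ?thesis using lt[OF t] by simp
  qed
  thus "block_choice s m f \<subseteq> {1..s * m}"
    by (auto simp: block_choice_def)
  have "inj_on (\<lambda>t. t * m + f t + 1) {..<s}"
    using lt by (auto intro!: inj_onI dest!: block_position_inj)
  thus "card (block_choice s m f) = s"
    by (simp add: block_choice_def card_image)
qed

lemma card_block_choice_Int:
  assumes f: "f \<in> block_choices s m" and g: "g \<in> block_choices s m"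
  shows "real (card (block_choice s m f \<inter> block_choice s m g)) = (\<Sum>t<s. of_bool (f t = g t))"
proof -
  have lt: "f t < m" "g t < m" if "t < s" for t using f g that by auto
  have "block_choice s m f \<inter> block_choice s m g = (\<lambda>t. t * m + f t + 1) ` ({..<s} \<inter> {t. f t = g t})"
  proof (intro equalityI subsetI)
    fix x assume "x \<in> block_choice s m f \<inter> block_choice s m g"
    then obtain t t' where t: "t < s" "t' < s" "x = t * m + f t + 1" "x = t' * m + g t' + 1"
      by (auto simp: block_choice_def)
    hence "t = t' \<and> f t = g t'"
      using block_position_inj[of t m "f t" t' "g t'"] lt by simp
    with t show "x \<in> (\<lambda>t. t * m + f t + 1) ` ({..<s} \<inter> {t. f t = g t})"
      by blast
  next
    fix x assume "x \<in> (\<lambda>t. t * m + f t + 1) ` ({..<s} \<inter> {t. f t = g t})"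
    then obtain t where t: "t < s" "f t = g t" "x = t * m + f t + 1"
      by blast
    hence "x = t * m + g t + 1" by simp
    with t show "x \<in> block_choice s m f \<inter> block_choice s m g"
      unfolding block_choice_def by blast
  qed
  moreover have "inj_on (\<lambda>t. t * m + f t + 1) ({..<s} \<inter> {t. f t = g t})"
    using lt by (auto intro!: inj_onI dest!: block_position_inj)
  ultimately show ?thesis
    by (simp only: card_image) simp
qed

text \<open>For fixed \<open>f\<close> and uniformly chosen \<open>g\<close>, the blocks in which the two sets agree form independent
  events of probability \<open>1 / m\<close>. The average of \<open>exp (t * overlap)\<close> is therefore
  \<open>(1 + (exp t - 1) / m) ^ s\<close>.\<close>

lemma sum_exp_overlap:
  assumes f: "f \<in> block_choices s m" and m: "m > 0"
  shows "(\<Sum>g\<in>block_choices s m. exp (t * real (card (block_choice s m f \<inter> block_choice s m g))))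
    \<le> real (card (block_choices s m)) * exp (real s * (exp t - 1) / real m)"
proof -
  have "(\<Sum>g\<in>block_choices s m. exp (t * real (card (block_choice s m f \<inter> block_choice s m g)))) =
      (\<Sum>g\<in>block_choices s m. \<Prod>u<s. exp (t * of_bool (f u = g u)))"
  proof (rule sum.cong)
    fix g assume "g \<in> block_choices s m"
    from card_block_choice_Int[OF f this]
    show "exp (t * real (card (block_choice s m f \<inter> block_choice s m g))) =
        (\<Prod>u<s. exp (t * of_bool (f u = g u)))"
      by (simp only: sum_distrib_left exp_sum finite_lessThan)
  qed simp
  also have "\<dots> = (\<Prod>u<s. \<Sum>v<m. exp (t * of_bool (f u = v)))"
    by (rule prod_sum_PiE[symmetric]) auto
  also have "\<dots> = (\<Prod>u<s. real m * (1 + (exp t - 1) / real m))"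
  proof (rule prod.cong)
    fix u assume "u \<in> {..<s}"
    hence u: "f u \<in> {..<m}" using f by auto
    have "(\<Sum>v<m. exp (t * of_bool (f u = v))) = (\<Sum>v<m. 1 + (if f u = v then exp t - 1 else 0))"
      by (rule sum.cong) auto
    also have "\<dots> = real m + (exp t - 1)"
      using u by (simp add: sum.distrib)
    also have "\<dots> = real m * (1 + (exp t - 1) / real m)"
      using m by (simp add: field_simps)
    finally show "(\<Sum>v<m. exp (t * of_bool (f u = v))) = real m * (1 + (exp t - 1) / real m)" .
  qed simp
  also have "\<dots> = real m ^ s * (1 + (exp t - 1) / real m) ^ s"
    by (simp add: power_mult_distrib)
  also have "\<dots> \<le> real m ^ s * exp ((exp t - 1) / real m) ^ s"
  proof (intro mult_left_mono power_mono)
    have "1 + (exp t - 1) / real m = (real m - 1 + exp t) / real m"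
      using m by (simp add: field_simps)
    also have "\<dots> \<ge> 0" using m by (intro divide_nonneg_nonneg add_nonneg_nonneg) auto
    finally show "0 \<le> 1 + (exp t - 1) / real m" .
  qed (auto intro: exp_ge_add_one_self)
  also have "real m ^ s = real (card (block_choices s m))"
    by (simp add: card_PiE)
  also have "exp ((exp t - 1) / real m) ^ s = exp (real s * (exp t - 1) / real m)"
    by (simp add: exp_of_nat_mult[symmetric])
  finally show ?thesis .
qed

section \<open>The lower bound on the risk\<close>

text \<open>Expanding the product gives two kinds of terms: products at a common vertex, which sum to at
  most \<open>n * card (S \<inter> S')\<close>, and products at the two ends, which sum to at most
  \<open>card S * card S'\<close>.\<close>

lemma sum_edge_overlap_le:
  assumes "S \<subseteq> {1..n}" "S' \<subseteq> {1..n}"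
  shows "(\<Sum>(i, j)\<in>edge_set n. (of_bool (i \<in> S) + of_bool (j \<in> S)) * (of_bool (i \<in> S') + of_bool (j \<in> S')))
    \<le> real n * real (card (S \<inter> S')) + real (card S) * real (card S')"
proof -
  define x y :: "nat \<Rightarrow> real" where "x i = of_bool (i \<in> S)" and "y i = of_bool (i \<in> S')" for i
  have sums: "sum x {1..n} = real (card S)" "sum y {1..n} = real (card S')"
    "(\<Sum>i\<in>{1..n}. x i * y i) = real (card (S \<inter> S'))"
    using assms by (simp_all add: x_def y_def Int_absorb1 Int_assoc[symmetric] flip: of_bool_conj Int_def)
  have "(\<Sum>(i, j)\<in>edge_set n. (x i + x j) * (y i + y j)) =
      (\<Sum>(i, j)\<in>edge_set n. (x i * y i + x i * y j) + (x j * y j + x j * y i))"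
    by (rule sum.cong) (auto simp: algebra_simps)
  also have "\<dots> = (\<Sum>i\<in>{1..n}. \<Sum>j\<in>{1..n} - {i}. x i * y i + x i * y j)"
    by (rule sum_edge_set_sym)
  also have "\<dots> \<le> (\<Sum>i\<in>{1..n}. \<Sum>j\<in>{1..n}. x i * y i + x i * y j)"
    by (intro sum_mono sum_mono2) (auto simp: x_def y_def)
  also have "\<dots> = real n * (\<Sum>i\<in>{1..n}. x i * y i) + sum x {1..n} * sum y {1..n}"
    by (simp add: sum.distrib sum_distrib_left[symmetric] sum_distrib_right[symmetric])
  finally show ?thesis
    unfolding sums by (simp add: x_def y_def)
qed

text \<open>For \<open>A \<le> 1 / 4\<close> the multiplier \<open>(1 + A) * (1 + A)\<close> is below 2, so no truncation takes place, and
  the relative increase is at most \<open>2 * A\<close> for each end in \<open>S\<close>. This makes it additive in the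
  two ends, the form that \<open>sum_edge_overlap_le\<close> handles.\<close>

lemma edge_coin_planted_shift:
  fixes C S
  assumes ab: "0 < b" "b < a" "a \<le> real n / 2" and A: "0 < A" "A \<le> 1 / 4"
    and ij: "(i, j) \<in> edge_set n"
  defines "p \<equiv> edge_coin n a b C (one_vec n)" and "q \<equiv> edge_coin n a b C (planted n A S)"
  shows "p (i, j) \<le> q (i, j)" and "q (i, j) \<le> 1"
    and "q (i, j) - p (i, j) \<le> p (i, j) * (2 * A * (of_bool (i \<in> S) + of_bool (j \<in> S)))"
proof -
  let ?c = "planted n A S i * planted n A S j"
  note pb = edge_coin_null_bounds[OF ab ij, of C, folded p_def]
  have ijn: "i \<in> {1..n}" "j \<in> {1..n}"
    using ij by (auto simp: edge_set_def)
  have AA: "A * A \<le> 1 / 4 * A" using A by (intro mult_right_mono) auto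
  have "(1 + A) * (1 + A) = 1 + (2 * A + A * A)" by (simp add: algebra_simps)
  hence sq: "1 \<le> (1 + A) * (1 + A)" "(1 + A) * (1 + A) \<le> 2" "(1 + A) * (1 + A) - 1 \<le> 4 * A"
    using A AA mult_pos_pos[OF A(1) A(1)] by linarith+
  have c: "1 \<le> ?c" "?c \<le> 2" "?c - 1 \<le> 2 * A * (of_bool (i \<in> S) + of_bool (j \<in> S))"
    by (cases "i \<in> S"; cases "j \<in> S"; use ijn A sq in \<open>simp add: planted_def\<close>)+
  have "?c * p (i, j) \<le> 2 * (1 / 2)"
    using c pb by (intro mult_mono) auto
  hence q: "q (i, j) = ?c * p (i, j)"
    unfolding q_def p_def by (subst edge_coin_scale[OF ab ij]) simp
  have "1 * p (i, j) \<le> ?c * p (i, j)"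
    using c pb by (intro mult_right_mono) auto
  thus "p (i, j) \<le> q (i, j)" by (simp add: q)
  show "q (i, j) \<le> 1" using \<open>?c * p (i, j) \<le> 2 * (1 / 2)\<close> by (simp add: q)
  have "p (i, j) * (?c - 1) \<le> p (i, j) * (2 * A * (of_bool (i \<in> S) + of_bool (j \<in> S)))"
    using c pb by (intro mult_left_mono) auto
  thus "q (i, j) - p (i, j) \<le> p (i, j) * (2 * A * (of_bool (i \<in> S) + of_bool (j \<in> S)))"
    by (simp add: q algebra_simps)
qed

text \<open>Each factor of the second moment is at most the exponential of its deviation from 1, and that
  deviation is at most \<open>p / (1 - p) * (2 * A)\<^sup>2 \<le> 8 * (a / n) * A\<^sup>2\<close> times the product of the
  numbers of ends in \<open>S\<close> and in \<open>S'\<close>.\<close>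

lemma planted_second_moment_le:
  fixes C
  assumes ab: "0 < b" "b < a" "a \<le> real n / 2" and A: "0 < A" "A \<le> 1 / 4"
    and S: "S \<subseteq> {1..n}" "S' \<subseteq> {1..n}"
  defines "p \<equiv> edge_coin n a b C (one_vec n)" and "q \<equiv> \<lambda>S. edge_coin n a b C (planted n A S)"
  shows "measure_pmf.expectation (coin_law (edge_set n) p)
      (\<lambda>e. likelihood_ratio (edge_set n) p (q S) e * likelihood_ratio (edge_set n) p (q S') e)
    \<le> exp (8 * a * A\<^sup>2 * (real (card (S \<inter> S')) + real (card S) * real (card S') / real n))"
proof -
  have n: "real n > 0" using ab by linarith
  define x where "x S i j = (of_bool (i \<in> S) + of_bool (j \<in> S) :: real)" for S and i j :: nat
  note pb = edge_coin_null_bounds[OF ab, of _ C, folded p_def]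
  have qb: "p (i, j) \<le> q S (i, j)" "q S (i, j) \<le> 1"
    "q S (i, j) - p (i, j) \<le> p (i, j) * (2 * A * x S i j)"
    if "(i, j) \<in> edge_set n" for i j S
    unfolding p_def q_def x_def by (rule edge_coin_planted_shift[OF ab A that])+
  have p01: "0 < p e \<and> p e < 1" if "e \<in> edge_set n" for e
    using pb(3,4)[OF that] by linarith
  have q01: "0 \<le> q S e \<and> q S e \<le> 1" if "e \<in> edge_set n" for S e
    using qb(1,2)[of "fst e" "snd e" S] p01[OF that] that by auto
  have edge: "1 + (q S e - p e) * (q S' e - p e) / (p e * (1 - p e)) \<le>
      exp (8 * (a / real n) * A\<^sup>2 * (x S (fst e) (snd e) * x S' (fst e) (snd e)))"
    if e: "e \<in> edge_set n" for e
  proof -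
    obtain i j where ij: "e = (i, j)" by force
    let ?z = "x S i j * x S' i j"
    have z: "0 \<le> ?z" by (simp add: x_def)
    have P: "0 < p e" "p e \<le> 1 / 2" "p e \<le> a / real n"
      using pb[OF e] by auto
    have "(q S e - p e) * (q S' e - p e) \<le> (p e * (2 * A * x S i j)) * (p e * (2 * A * x S' i j))"
      using qb(1,3)[of i j S] qb(1,3)[of i j S'] e A P(1)
      by (intro mult_mono) (auto simp: ij x_def)
    also have "\<dots> = (4 * p e * A\<^sup>2 * ?z) * p e"
      by (simp add: power2_eq_square)
    also have "\<dots> \<le> (4 * p e * A\<^sup>2 * ?z) * (p e * (2 * (1 - p e)))"
      using P z A by (intro mult_left_mono) (auto intro!: mult_nonneg_nonneg)
    also have "\<dots> = (8 * p e * A\<^sup>2 * ?z) * (p e * (1 - p e))"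
      by simp
    finally have "(q S e - p e) * (q S' e - p e) / (p e * (1 - p e)) \<le> 8 * p e * A\<^sup>2 * ?z"
      using P by (subst pos_divide_le_eq) auto
    also have "\<dots> \<le> 8 * (a / real n) * A\<^sup>2 * ?z"
      using P z by (intro mult_right_mono mult_left_mono) auto
    finally show ?thesis
      using exp_ge_add_one_self[of "8 * (a / real n) * A\<^sup>2 * ?z"] unfolding ij fst_conv snd_conv by linarith
  qed
  have "measure_pmf.expectation (coin_law (edge_set n) p)
      (\<lambda>e. likelihood_ratio (edge_set n) p (q S) e * likelihood_ratio (edge_set n) p (q S') e) =
      (\<Prod>e\<in>edge_set n. 1 + (q S e - p e) * (q S' e - p e) / (p e * (1 - p e)))"
    by (rule expectation_likelihood_ratio_product) (use p01 q01 in auto)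
  also have "\<dots> \<le> (\<Prod>e\<in>edge_set n. exp (8 * (a / real n) * A\<^sup>2 * (x S (fst e) (snd e) * x S' (fst e) (snd e))))"
  proof (intro prod_mono conjI edge)
    fix e assume e: "e \<in> edge_set n"
    show "0 \<le> 1 + (q S e - p e) * (q S' e - p e) / (p e * (1 - p e))"
      using qb(1)[of "fst e" "snd e"] e p01[OF e]
      by (intro add_nonneg_nonneg divide_nonneg_nonneg mult_nonneg_nonneg) auto
  qed
  also have "\<dots> = exp (8 * (a / real n) * A\<^sup>2 * (\<Sum>(i, j)\<in>edge_set n. x S i j * x S' i j))"
    by (simp add: exp_sum[symmetric] sum_distrib_left case_prod_unfold)
  also have "\<dots> \<le> exp (8 * (a / real n) * A\<^sup>2 *
      (real n * real (card (S \<inter> S')) + real (card S) * real (card S')))"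
    using sum_edge_overlap_le[OF S] ab
    by (subst exp_le_cancel_iff, intro mult_left_mono) (auto simp: x_def)
  also have "8 * (a / real n) * A\<^sup>2 * (real n * real (card (S \<inter> S')) + real (card S) * real (card S')) =
      8 * a * A\<^sup>2 * (real (card (S \<inter> S')) + real (card S) * real (card S') / real n)"
    using n by (simp add: field_simps)
  finally show ?thesis .
qed

lemma risk_ge_average:
  assumes C: "C \<in> community_class n k \<nu>" and I: "finite I" "I \<noteq> {}"
    and \<Theta>: "\<And>f. f \<in> I \<Longrightarrow> \<Theta> f \<in> alternatives n s A"
  shows "measure_pmf.prob (graph_law n a b C (one_vec n)) {Y. T Y}
      + (\<Sum>f\<in>I. measure_pmf.prob (graph_law n a b C (\<Theta> f)) {Y. \<not> T Y}) / real (card I)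
    \<le> risk n a b k \<nu> s A T"
proof -
  let ?CC = "community_class n k \<nu>"
  let ?sup = "SUP \<Theta>\<in>alternatives n s A. MAX C\<in>?CC.
    measure_pmf.prob (graph_law n a b C \<Theta>) {Y. \<not> T Y}"
  have "measure_pmf.prob (graph_law n a b C (\<Theta> f)) {Y. \<not> T Y} \<le> ?sup" if "f \<in> I" for f
  proof (rule cSUP_upper2[OF _ \<Theta>[OF that]])
    have "?CC \<noteq> {}" using C by blast
    thus "bdd_above ((\<lambda>\<Theta>. MAX C\<in>?CC. measure_pmf.prob (graph_law n a b C \<Theta>) {Y. \<not> T Y}) `
        alternatives n s A)"
      by (auto intro!: bdd_aboveI[of _ 1] Max.boundedI)
  qed (use C in auto)
  hence "(\<Sum>f\<in>I. measure_pmf.prob (graph_law n a b C (\<Theta> f)) {Y. \<not> T Y}) \<le> real (card I) * ?sup"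
    by (intro sum_bounded_above) auto
  hence "(\<Sum>f\<in>I. measure_pmf.prob (graph_law n a b C (\<Theta> f)) {Y. \<not> T Y}) / real (card I) \<le> ?sup"
    using I by (simp add: field_simps card_gt_0_iff)
  moreover have "measure_pmf.prob (graph_law n a b C (one_vec n)) {Y. T Y} \<le>
      (MAX C\<in>?CC. measure_pmf.prob (graph_law n a b C (one_vec n)) {Y. T Y})"
    using C by (intro Max_ge) auto
  ultimately show ?thesis
    unfolding risk_def family_risk_def by linarith
qed

text \<open>With \<open>t = 8 * a * A\<^sup>2 \<le> 1\<close> and blocks of size \<open>m = n div s \<ge> n / (2 * s)\<close>, the random
  overlap contributes \<open>s * (exp t - 1) / m \<le> 4 * t * s\<^sup>2 / n\<close> to the exponent, and the
  deterministic part of the pair bound contributes \<open>t * s\<^sup>2 / n\<close>; the total \<open>5 * t\<close> gives the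
  constant 40.\<close>

lemma risk_lower_bound:
  assumes ab: "0 < b" "b < a" "a \<le> real n / 2" and CC: "community_class n k \<nu> \<noteq> {}"
    and s: "1 \<le> s" "s \<le> n" and A: "0 < A" "A \<le> 1 / 4" and t1: "8 * (a * A\<^sup>2) \<le> 1"
  shows "1 - sqrt (exp (40 * (a * A\<^sup>2) * (real s)\<^sup>2 / real n) - 1) \<le> risk n a b k \<nu> s A T"
proof -
  obtain C where C: "C \<in> community_class n k \<nu>" using CC by blast
  define m where "m = n div s"
  define I where "I = block_choices s m"
  define S where "S = block_choice s m"
  define p where "p = edge_coin n a b C (one_vec n)"
  define q where "q = (\<lambda>S. edge_coin n a b C (planted n A S))"
  define t where "t = 8 * a * A\<^sup>2"
  have n: "real n > 0" using ab by linarith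
  have m: "m > 0" using s by (auto simp: m_def div_greater_zero_iff)
  have sm: "s * m \<le> n" by (simp add: m_def)
  have "n < s * (m + 1)"
    using dividend_less_times_div[of s n] s by (simp add: m_def)
  also have "s * (m + 1) \<le> 2 * (s * m)"
    using m by (simp add: algebra_simps)
  finally have nsm: "real n \<le> 2 * (real s * real m)"
    by (metis less_imp_le of_nat_le_iff of_nat_mult of_nat_numeral)
  have t: "0 \<le> t" "t \<le> 1" using ab t1 by (auto simp: t_def mult_ac)
  have I: "finite I" "I \<noteq> {}" using m by (auto simp: I_def finite_PiE PiE_eq_empty_iff)
  have Sf: "S f \<subseteq> {1..n}" "card (S f) = s" if "f \<in> I" for f
    using block_choice_props[of f s m] that sm by (auto simp: I_def S_def)
  have "exp t \<le> 1 + t + t\<^sup>2" using t by (rule exp_bound)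
  moreover have "t\<^sup>2 \<le> t * 1" unfolding power2_eq_square using t by (intro mult_left_mono) auto
  ultimately have "exp t - 1 \<le> 2 * t" by simp
  hence "real s * (exp t - 1) / real m \<le> real s * (2 * t) / real m"
    by (intro divide_right_mono mult_left_mono) auto
  also have "\<dots> \<le> 4 * t * (real s)\<^sup>2 / real n"
  proof -
    have "real s * (2 * t) * real n \<le> real s * (2 * t) * (2 * (real s * real m))"
      using nsm t by (intro mult_left_mono) auto
    thus ?thesis using n m by (simp add: field_simps power2_eq_square)
  qed
  finally have overlap: "real s * (exp t - 1) / real m \<le> 4 * t * (real s)\<^sup>2 / real n" .
  define L where "L = (\<lambda>f. likelihood_ratio (edge_set n) p (q (S f)))"
  define K where "K = exp (40 * (a * A\<^sup>2) * (real s)\<^sup>2 / real n)"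
  let ?E = "measure_pmf.expectation (coin_law (edge_set n) p)"
  have inner: "(\<Sum>g\<in>I. ?E (\<lambda>e. L f e * L g e)) \<le> real (card I) * K" if f: "f \<in> I" for f
  proof -
    have "(\<Sum>g\<in>I. ?E (\<lambda>e. L f e * L g e)) \<le>
        (\<Sum>g\<in>I. exp (t * (real s)\<^sup>2 / real n) * exp (t * real (card (S f \<inter> S g))))"
    proof (rule sum_mono)
      fix g assume g: "g \<in> I"
      show "?E (\<lambda>e. L f e * L g e) \<le> exp (t * (real s)\<^sup>2 / real n) * exp (t * real (card (S f \<inter> S g)))"
        using planted_second_moment_le[OF ab A Sf(1)[OF f] Sf(1)[OF g], of C]
        by (simp add: L_def p_def q_def Sf(2)[OF f] Sf(2)[OF g] t_def power2_eq_square
            distrib_left exp_add[symmetric] add.commute)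
    qed
    also have "\<dots> \<le> exp (t * (real s)\<^sup>2 / real n) *
        (real (card I) * exp (real s * (exp t - 1) / real m))"
      unfolding sum_distrib_left[symmetric] I_def S_def
      using f m by (intro mult_left_mono sum_exp_overlap) (auto simp: I_def)
    also have "\<dots> \<le> exp (t * (real s)\<^sup>2 / real n) *
        (real (card I) * exp (4 * t * (real s)\<^sup>2 / real n))"
      using overlap by (intro mult_left_mono) auto
    also have "\<dots> = real (card I) * exp (t * (real s)\<^sup>2 / real n + 4 * t * (real s)\<^sup>2 / real n)"
      by (simp only: exp_add mult_ac)
    also have "t * (real s)\<^sup>2 / real n + 4 * t * (real s)\<^sup>2 / real n = 40 * (a * A\<^sup>2) * (real s)\<^sup>2 / real n"
      by (simp add: t_def field_simps)
    finally show ?thesis by (simp add: K_def)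
  qed
  have "(\<Sum>f\<in>I. \<Sum>g\<in>I. ?E (\<lambda>e. L f e * L g e)) \<le> real (card I) * (real (card I) * K)"
    by (intro sum_bounded_above inner)
  hence second: "(\<Sum>f\<in>I. \<Sum>g\<in>I. ?E (\<lambda>e. L f e * L g e)) \<le> K * (real (card I))\<^sup>2"
    by (simp add: power2_eq_square mult_ac)
  have p01: "0 < p e \<and> p e < 1" if "e \<in> edge_set n" for e
    using edge_coin_null_bounds(3,4)[OF ab that, of C] by (simp add: p_def)
  have q01: "0 \<le> q R e \<and> q R e \<le> 1" if "e \<in> edge_set n" for R e
    using edge_coin_planted_shift(1,2)[OF ab A, of "fst e" "snd e" C R] p01[OF that] that
    by (auto simp: p_def q_def)
  have "1 - sqrt (K - 1) \<le> measure_pmf.prob (coin_law (edge_set n) p) {e. T (to_adjacency e)}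
      + (\<Sum>f\<in>I. measure_pmf.prob (coin_law (edge_set n) (q (S f))) (- {e. T (to_adjacency e)})) / real (card I)"
    by (rule mixture_testing_lower_bound[OF _ I _ second])
       (use p01 q01 in \<open>auto simp: L_def intro!: pmf_coin_law_likelihood_ratio\<close>)
  also have "\<dots> = measure_pmf.prob (graph_law n a b C (one_vec n)) {Y. T Y}
      + (\<Sum>f\<in>I. measure_pmf.prob (graph_law n a b C (planted n A (S f))) {Y. \<not> T Y}) / real (card I)"
    by (simp add: graph_law_eq_coin_law p_def q_def vimage_def Compl_eq)
  also have "\<dots> \<le> risk n a b k \<nu> s A T"
    by (rule risk_ge_average[OF C I]) (rule planted_in_alternatives[OF Sf A(1)])
  finally show ?thesis by (simp add: K_def)
qed

section \<open>Sizes with a nonempty community class\<close>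

lemma equal_blocks_class_nonempty:
  assumes "k \<ge> 1" "\<nu> \<ge> 1" "m \<ge> 1"
  shows "community_class (k * m) k \<nu> \<noteq> {}"
proof -
  define B where "B l = {l * m<..l * m + m}" for l
  have disj: "l = l'" if "i \<in> B l" "i \<in> B l'" for i l l'
  proof -
    have "l * m < i" "i \<le> l * m + m" "l' * m < i" "i \<le> l' * m + m"
      using that by (auto simp: B_def)
    thus ?thesis
      using block_position_inj[of l m "i - 1 - l * m" l' "i - 1 - l' * m"] by auto
  qed
  have ne: "B l \<noteq> {}" for l using assms by (auto simp: B_def)
  have "inj_on B {..<k}" using disj ne by (intro inj_onI) blast
  hence card: "card (B ` {..<k}) = k" by (simp add: card_image)
  have union: "\<Union> (B ` {..<k}) = {1..k * m}"
  proof (intro equalityI subsetI)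
    fix i assume "i \<in> \<Union> (B ` {..<k})"
    then obtain l where l: "l < k" "l * m < i" "i \<le> l * m + m" by (auto simp: B_def)
    have "l * m + m \<le> k * m" using mult_le_mono1[of "Suc l" k m] l by simp
    thus "i \<in> {1..k * m}" using l by simp
  next
    fix i assume i: "i \<in> {1..k * m}"
    hence "i - 1 < k * m" by auto
    hence "(i - 1) div m < k" by (simp add: less_mult_imp_div_less)
    moreover have "i \<in> B ((i - 1) div m)"
    proof -
      define u v where "u = (i - 1) div m * m" and "v = (i - 1) mod m"
      have "u + v = i - 1" "v < m" "1 \<le> i"
        using assms i by (simp_all add: u_def v_def)
      hence "u < i" "i \<le> u + m" by linarith+
      thus ?thesis by (simp add: B_def u_def)
    qed
    ultimately show "i \<in> \<Union> (B ` {..<k})" by blast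
  qed
  have part: "partition_on {1..k * m} (B ` {..<k})"
  proof (rule partition_onI)
    show "{} \<notin> B ` {..<k}" using ne by blast
    show "disjnt p p'" if "p \<in> B ` {..<k}" "p' \<in> B ` {..<k}" "p \<noteq> p'" for p p'
      using disj that unfolding disjnt_iff by blast
  qed (fact union)
  have k: "real k > 0" using assms by simp
  have "real m * 1 \<le> real m * \<nu>" using assms by (intro mult_left_mono) auto
  hence "real m / \<nu> \<le> real m" "real m \<le> real m * \<nu>"
    using assms by (auto simp: field_simps)
  hence "B ` {..<k} \<in> community_class (k * m) k \<nu>"
    using part card k by (auto simp: community_class_def B_def)
  thus ?thesis by blast
qed

text \<open>Over the trivial filter every upper limit is \<open>-\<infinity>\<close>, hence never 0. Multiples of \<open>k\<close> admit
  equal blocks, which are admissible for every \<open>\<nu> \<ge> 1\<close>.\<close>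

lemma class_sequentially_nontrivial:
  assumes "k \<ge> 1" "\<nu> \<ge> 1"
  shows "class_sequentially k \<nu> \<noteq> bot"
proof
  assume "class_sequentially k \<nu> = bot"
  hence "eventually (\<lambda>n. community_class n k \<nu> = {}) sequentially"
    by (simp add: trivial_limit_def class_sequentially_def eventually_inf_principal)
  then obtain N where "\<And>n. n \<ge> N \<Longrightarrow> community_class n k \<nu> = {}"
    by (auto simp: eventually_sequentially)
  moreover have "k * Suc N \<ge> N" using assms by (cases k) auto
  ultimately show False
    using equal_blocks_class_nonempty[OF assms, of "Suc N"] by auto
qed

lemma eventually_class_sequentially:
  assumes "eventually P sequentially"
  shows "eventually (\<lambda>n. community_class n k \<nu> \<noteq> {} \<and> P n) (class_sequentially k \<nu>)"
  using assms unfolding class_sequentially_def eventually_inf_principal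
  by eventually_elim simp

lemma class_sequentially_le: "class_sequentially k \<nu> \<le> sequentially"
  by (simp add: class_sequentially_def)

section \<open>The detection threshold\<close>

lemma eventually_gt_of_Liminf_pos:
  assumes "0 < Liminf F (\<lambda>n. ereal (f n))"
  obtains c where "c > 0" "eventually (\<lambda>n. c < f n) F"
proof -
  obtain c where c: "0 < ereal c" "ereal c < Liminf F (\<lambda>n. ereal (f n))"
    using assms ereal_dense2[of 0] by (metis)
  show ?thesis
    using that[of c] less_LiminfD[OF c(2)] c(1) by simp
qed

lemma eventually_powr_dominates:
  fixes x y c :: real
  assumes "x < y"
  shows "eventually (\<lambda>n. c * real n powr x \<le> real n powr y) sequentially"
proof -
  have "filterlim (\<lambda>n. real n powr (y - x)) at_top sequentially"
    using assms by real_asymp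
  hence "eventually (\<lambda>n. c \<le> real n powr (y - x)) sequentially"
    by (simp add: filterlim_at_top)
  thus ?thesis using eventually_gt_at_top[of 0]
  proof eventually_elim
    case (elim n)
    hence "c * real n powr x \<le> real n powr (y - x) * real n powr x"
      by (intro mult_right_mono) auto
    thus ?case by (simp add: powr_add[symmetric])
  qed
qed

theorem theorem3p1:
  fixes k :: nat and \<nu> \<alpha> :: real and a b :: "nat \<Rightarrow> real" and s :: "nat \<Rightarrow> nat"
  assumes k: "k \<ge> 1" and nu: "\<nu> \<ge> 1"
    and ab: "\<And>n. n \<ge> 1 \<Longrightarrow> 0 < b n \<and> b n < a n \<and> a n \<le> real n / 2"
    and ratio_liminf: "0 < Liminf sequentially (\<lambda>n. ereal (b n / a n))"
    and ratio_limsup: "Limsup sequentially (\<lambda>n. ereal (b n / a n)) < 1"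
    and a_liminf: "0 < Liminf sequentially (\<lambda>n. ereal (a n))"
    and b_liminf: "0 < Liminf sequentially (\<lambda>n. ereal (b n))"
    and tau_a: "convergent (\<lambda>n. a n / real n)"
    and tau_b: "convergent (\<lambda>n. b n / real n)"
    and alpha: "0 < \<alpha>" "\<alpha> \<le> 1 / 2"
    \<comment> \<open>\<open>s n\<close> is \<open>n powr (1 - \<alpha>)\<close> rounded to an integer, either way\<close>
    and s: "\<And>n. n \<ge> 1 \<Longrightarrow> \<bar>real (s n) - real n powr (1 - \<alpha>)\<bar> < 1"
  shows "(\<forall>r A. r < C_dense \<alpha> \<and>
            (\<forall>n\<ge>1. A n > 0 \<and> A n \<ge> real n powr (- r) / sqrt (a n)) \<longrightarrow>
            (\<exists>\<kappa> :: nat \<Rightarrow> real. asymptotically_powerful (class_sequentially k \<nu>)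
               (\<lambda>n. family_risk n (a n) (b n) k \<nu> (s n) (A n)
                      (total_degree_test n (a n) (b n) (\<kappa> n)))))
       \<and> (\<forall>r A. r > C_dense \<alpha> \<and>
            (\<forall>n\<ge>1. A n > 0 \<and> A n \<le> real n powr (- r) / sqrt (a n)) \<longrightarrow>
            (\<forall>T :: nat \<Rightarrow> adjacency \<Rightarrow> bool. asymptotically_powerless (class_sequentially k \<nu>)
               (\<lambda>n. risk n (a n) (b n) k \<nu> (s n) (A n) (T n))))"
proof -
  define F where "F = class_sequentially k \<nu>"
  have F: "F \<noteq> bot" "F \<le> sequentially"
    using class_sequentially_nontrivial[OF k nu] class_sequentially_le by (auto simp: F_def)
  obtain c where c: "c > 0" and ev_c: "eventually (\<lambda>n. c < b n / a n) sequentially"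
    using eventually_gt_of_Liminf_pos[OF ratio_liminf] by blast
  obtain b0 where b0: "b0 > 0" and ev_b0: "eventually (\<lambda>n. b0 < b n) sequentially"
    using eventually_gt_of_Liminf_pos[OF b_liminf] by blast
  have "eventually (\<lambda>n. 2 * real n powr 0 \<le> real n powr (1 - \<alpha>)) sequentially"
    by (rule eventually_powr_dominates) (use alpha in simp)
  moreover have "eventually (\<lambda>n. 4 * real n powr (1 - \<alpha>) \<le> real n powr 1) sequentially"
    by (rule eventually_powr_dominates) (use alpha in simp)
  ultimately have ev_s: "eventually (\<lambda>n. real n powr (1 - \<alpha>) / 2 \<le> real (s n) \<and>
      real (s n) \<le> 2 * real n powr (1 - \<alpha>) \<and> 1 \<le> s n \<and> real (s n) \<le> real n / 2) sequentially"
    using eventually_gt_at_top[of 0]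
  proof eventually_elim
    case (elim n)
    hence "\<bar>real (s n) - real n powr (1 - \<alpha>)\<bar> < 1" "2 \<le> real n powr (1 - \<alpha>)"
      "4 * real n powr (1 - \<alpha>) \<le> real n"
      using s[of n] by auto
    thus ?case by linarith
  qed
  have powerful: "\<exists>\<kappa> :: nat \<Rightarrow> real. asymptotically_powerful F
      (\<lambda>n. family_risk n (a n) (b n) k \<nu> (s n) (A n) (total_degree_test n (a n) (b n) (\<kappa> n)))"
    if r: "r < C_dense \<alpha>" and A: "\<And>n. n \<ge> 1 \<Longrightarrow> A n > 0 \<and> A n \<ge> real n powr (- r) / sqrt (a n)"
    for r A
  proof -
    \<comment> \<open>The cutoff \<open>\<kappa> = n powr \<epsilon>\<close> must tend to infinity, yet stay below the ratio of the mean shift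
      to the null standard deviation. That ratio is at least of order \<open>n powr (1 / 2 - \<alpha> - r)\<close> or,
      when \<open>A * b / n\<close> exceeds \<open>1 / 2\<close>, of order \<open>n powr (1 - \<alpha>)\<close>; the bound \<open>1 / 4\<close> covers
      the second case.\<close>
    define \<epsilon> where "\<epsilon> = min ((1 / 2 - \<alpha> - r) / 2) (1 / 4)"
    have \<epsilon>: "\<epsilon> > 0" "\<epsilon> < 1 / 2 - \<alpha> - r" "\<epsilon> \<le> 1 / 4"
      using r by (auto simp: \<epsilon>_def C_dense_def min_def)
    define \<kappa> where "\<kappa> n = real n powr \<epsilon>" for n :: nat
    define R where "R n = family_risk n (a n) (b n) k \<nu> (s n) (A n)
      (total_degree_test n (a n) (b n) (\<kappa> n))" for n
    have "eventually (\<lambda>n. (8 / c) * real n powr (\<epsilon> + 1 / 2) \<le> real n powr (1 - \<alpha> - r)) sequentially"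
      by (rule eventually_powr_dominates) (use \<epsilon> in simp)
    moreover have "eventually (\<lambda>n. 16 * real n powr (\<epsilon> + 1) \<le> real n powr (2 - \<alpha>)) sequentially"
      by (rule eventually_powr_dominates) (use \<epsilon> alpha in simp)
    moreover have "eventually (\<lambda>n. 2 / b0 + 1 \<le> real n) sequentially"
      by real_asymp
    ultimately have "eventually (\<lambda>n. community_class n k \<nu> \<noteq> {} \<longrightarrow>
        R n \<le> 2 / (\<kappa> n)\<^sup>2 + 2 / \<kappa> n \<and> 0 \<le> R n) sequentially"
      using ev_s ev_c ev_b0 eventually_ge_at_top[of 2]
    proof eventually_elim
      case (elim n)
      have n: "n \<ge> 1" "real n > 0" using elim by auto
      have abn: "0 < b n" "b n < a n" "a n \<le> real n / 2" using ab[OF n(1)] by auto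
      have An: "A n > 0" "real n powr (- r) / sqrt (a n) \<le> A n" using A[OF n(1)] by auto
      have sn: "s n \<le> n" using elim by linarith
      have \<kappa>n: "\<kappa> n > 0" using n by (simp add: \<kappa>_def)
      have ca: "c * a n \<le> b n" using elim abn by (simp add: field_simps)
      have "(2 / b0) * b0 \<le> (real n - 1) * b n"
        using elim b0 by (intro mult_mono) auto
      hence M: "2 \<le> (real n - 1) * b n" using b0 by simp
      have size: "real n powr (1 - \<alpha>) * real n / 4 \<le> real (s n) * (real n - real (s n))"
      proof -
        have "real n powr (1 - \<alpha>) / 2 * (real n / 2) \<le> real (s n) * (real n - real (s n))"
          using elim by (intro mult_mono) auto
        thus ?thesis by simp
      qed
      have sq: "sqrt (a n) * sqrt (a n) = a n" "sqrt (a n) > 0" using abn by auto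
      have le_mult_min: "x \<le> y * u \<Longrightarrow> x \<le> y * v \<Longrightarrow> x \<le> y * min u v"
        for x y u v :: real
        by (simp add: min_def)
      have "2 * \<kappa> n * sqrt (real n * a n) \<le> real n powr (1 - \<alpha>) * real n / 4 * (A n * b n / real n)"
      proof -
        have "2 * \<kappa> n * sqrt (real n * a n) = 2 * real n powr (\<epsilon> + 1 / 2) * sqrt (a n)"
          by (simp add: \<kappa>_def powr_add powr_half_sqrt real_sqrt_mult)
        also have "\<dots> = c / 4 * ((8 / c) * real n powr (\<epsilon> + 1 / 2)) * sqrt (a n)"
          using c by simp
        also have "\<dots> \<le> c / 4 * real n powr (1 - \<alpha> - r) * sqrt (a n)"
          using elim c sq by (intro mult_left_mono mult_right_mono) auto
        also have "\<dots> = real n powr (1 - \<alpha>) / 4 * (real n powr (- r) / sqrt (a n) * (c * a n))"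
        proof -
          have "real n powr (1 - \<alpha> - r) = real n powr (1 - \<alpha>) * real n powr (- r)"
            by (simp flip: powr_add)
          moreover have "real n powr (- r) / sqrt (a n) * (c * a n) = c * real n powr (- r) * sqrt (a n)"
            using sq by (simp add: field_simps)
          ultimately show ?thesis by simp
        qed
        also have "\<dots> \<le> real n powr (1 - \<alpha>) / 4 * (A n * b n)"
          using An ca abn c by (intro mult_left_mono mult_mono) auto
        also have "\<dots> = real n powr (1 - \<alpha>) * real n / 4 * (A n * b n / real n)"
          using n by simp
        finally show ?thesis .
      qed
      moreover have "2 * \<kappa> n * sqrt (real n * a n) \<le> real n powr (1 - \<alpha>) * real n / 4 * (1 / 2)"
      proof -
        have "real n * a n \<le> real n * real n"
          using abn n by (intro mult_left_mono) auto
        hence "sqrt (real n * a n) \<le> real n"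
          using n by (intro real_le_lsqrt) (auto simp: power2_eq_square)
        hence "2 * \<kappa> n * sqrt (real n * a n) \<le> 2 * \<kappa> n * real n"
          using \<kappa>n by (intro mult_left_mono) auto
        also have "\<dots> = 2 * real n powr (\<epsilon> + 1)"
          using n by (simp add: \<kappa>_def powr_add)
        also have "\<dots> \<le> real n powr (2 - \<alpha>) / 8" using elim by simp
        also have "real n powr (2 - \<alpha>) = real n powr (1 - \<alpha>) * real n powr 1"
          unfolding powr_add[symmetric] by simp
        finally show ?thesis using n by simp
      qed
      ultimately have "2 * \<kappa> n * sqrt (real n * a n) \<le>
          real n powr (1 - \<alpha>) * real n / 4 * min (A n * b n / real n) (1 / 2)"
        by (rule le_mult_min)
      also have "\<dots> \<le> real (s n) * (real n - real (s n)) * min (A n * b n / real n) (1 / 2)"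
        using An abn by (intro mult_right_mono size) auto
      finally have signal: "2 * \<kappa> n * sqrt (real n * a n) \<le>
          real (s n) * (real n - real (s n)) * min (A n * b n / real n) (1 / 2)" .
      show ?case
        using total_degree_test_family_risk[OF abn _ _ sn An(1) \<kappa>n M signal, of k \<nu>]
          family_risk_nonneg[OF _ sn An(1)] elim
        by (auto simp: R_def)
    qed
    from eventually_class_sequentially[OF this, of k \<nu>, folded F_def]
    have ev: "eventually (\<lambda>n. 0 \<le> R n) F" "eventually (\<lambda>n. R n \<le> 2 / (\<kappa> n)\<^sup>2 + 2 / \<kappa> n) F"
      by (auto elim: eventually_mono)
    have "(\<lambda>n. 2 / (\<kappa> n)\<^sup>2 + 2 / \<kappa> n) \<longlonglongrightarrow> 0"
      unfolding \<kappa>_def using \<epsilon>(1) by real_asymp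
    from tendsto_sandwich[OF ev tendsto_const tendsto_mono[OF F(2) this]]
    have lim: "((\<lambda>n. ereal (R n)) \<longlongrightarrow> ereal 0) F" by (rule tendsto_ereal)
    have "asymptotically_powerful F R"
      unfolding asymptotically_powerful_def using lim_imp_Limsup[OF F(1) lim] by (simp add: zero_ereal_def)
    thus ?thesis unfolding R_def by blast
  qed
  have powerless: "asymptotically_powerless F (\<lambda>n. risk n (a n) (b n) k \<nu> (s n) (A n) (T n))"
    if r: "r > C_dense \<alpha>" and A: "\<And>n. n \<ge> 1 \<Longrightarrow> A n > 0 \<and> A n \<le> real n powr (- r) / sqrt (a n)"
    for r A and T :: "nat \<Rightarrow> adjacency \<Rightarrow> bool"
  proof -
    have r0: "r > 0" and d: "1 - 2 * \<alpha> - 2 * r < 0"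
      using r alpha by (auto simp: C_dense_def)
    define g where "g n = 1 - sqrt (exp (160 * real n powr (1 - 2 * \<alpha> - 2 * r)) - 1)" for n :: nat
    have "eventually (\<lambda>n. (4 / sqrt b0) * real n powr (- r) \<le> real n powr 0) sequentially"
      by (rule eventually_powr_dominates) (use r0 in simp)
    moreover have "eventually (\<lambda>n. 8 * real n powr (- 2 * r) \<le> real n powr 0) sequentially"
      by (rule eventually_powr_dominates) (use r0 in simp)
    ultimately have "eventually (\<lambda>n. community_class n k \<nu> \<noteq> {} \<longrightarrow>
        g n \<le> risk n (a n) (b n) k \<nu> (s n) (A n) (T n)) sequentially"
      using ev_s ev_b0 eventually_ge_at_top[of 2]
    proof eventually_elim
      case (elim n)
      have n: "n \<ge> 1" "real n > 0" using elim by auto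
      have abn: "0 < b n" "b n < a n" "a n \<le> real n / 2" using ab[OF n(1)] by auto
      have An: "A n > 0" "A n \<le> real n powr (- r) / sqrt (a n)" using A[OF n(1)] by auto
      have sn: "1 \<le> s n" "s n \<le> n" using elim by linarith+
      have "A n \<le> real n powr (- r) / sqrt b0"
      proof (rule order_trans[OF An(2)])
        have "sqrt b0 \<le> sqrt (a n)" "0 < sqrt b0" using elim abn b0 by auto
        thus "real n powr (- r) / sqrt (a n) \<le> real n powr (- r) / sqrt b0"
          by (intro divide_left_mono mult_pos_pos) auto
      qed
      also have "\<dots> \<le> 1 / 4" using elim(1) n by (simp add: mult.commute)
      finally have A4: "A n \<le> 1 / 4" .
      have "(A n)\<^sup>2 \<le> (real n powr (- r) / sqrt (a n))\<^sup>2"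
        using An by (intro power_mono) auto
      also have "\<dots> = real n powr (- 2 * r) / a n"
        using abn n by (simp add: power_divide powr_power)
      finally have aA: "a n * (A n)\<^sup>2 \<le> real n powr (- 2 * r)"
        using abn by (simp add: field_simps)
      have "8 * (a n * (A n)\<^sup>2) \<le> 1" using aA elim n by simp
      note lower = risk_lower_bound[OF abn _ sn An(1) A4 this, of k \<nu> "T n"]
      have "(real (s n))\<^sup>2 \<le> (2 * real n powr (1 - \<alpha>))\<^sup>2"
        using elim by (intro power_mono) auto
      also have "\<dots> = 4 * real n powr (2 - 2 * \<alpha>)"
        using n by (simp add: power_mult_distrib powr_power algebra_simps)
      finally have s2: "(real (s n))\<^sup>2 \<le> 4 * real n powr (2 - 2 * \<alpha>)" .
      have "40 * (a n * (A n)\<^sup>2) * (real (s n))\<^sup>2 / real n \<le>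
          40 * real n powr (- 2 * r) * (4 * real n powr (2 - 2 * \<alpha>)) / real n"
        using aA s2 abn by (intro divide_right_mono mult_mono) auto
      also have "\<dots> = 160 * (real n powr (- 2 * r) * real n powr (2 - 2 * \<alpha>) * real n powr (- 1))"
        using n by (simp add: powr_minus divide_inverse)
      also have "\<dots> = 160 * real n powr (1 - 2 * \<alpha> - 2 * r)"
        unfolding powr_add[symmetric] by (simp add: algebra_simps)
      finally have "g n \<le> 1 - sqrt (exp (40 * (a n * (A n)\<^sup>2) * (real (s n))\<^sup>2 / real n) - 1)"
        by (simp add: g_def)
      thus ?case using lower by (meson order_trans)
    qed
    from eventually_class_sequentially[OF this, of k \<nu>, folded F_def]
    have ev: "eventually (\<lambda>n. ereal (g n) \<le> ereal (risk n (a n) (b n) k \<nu> (s n) (A n) (T n))) F"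
      by (auto elim: eventually_mono)
    have "(\<lambda>n. real n powr (1 - 2 * \<alpha> - 2 * r)) \<longlonglongrightarrow> 0"
      using d by real_asymp
    hence "g \<longlonglongrightarrow> 1 - sqrt (exp (160 * 0) - 1)"
      unfolding g_def by (intro tendsto_intros)
    hence "((\<lambda>n. ereal (g n)) \<longlongrightarrow> ereal 1) F"
      using tendsto_mono[OF F(2)] by (intro tendsto_ereal) auto
    from lim_imp_Liminf[OF F(1) this] Liminf_mono[OF ev]
    show ?thesis
      unfolding asymptotically_powerless_def by (simp add: one_ereal_def)
  qed
  show ?thesis
    using powerful powerless unfolding F_def by blast
qed

end
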